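(* Let $H=H(p,q,t)$ be a toroidal polyhex with two cut cycles $L_x$ and $L_y$. Two perfect matchings $M_1,M_2$ of $H$ lie in the same connected component of the resonance graph $R_6(H)$ if and only if ${\rm flow}_{L_j}(H,M_1)={\rm flow}_{L_j}(H,M_2)$ for both $j=x$ and $j=y$, and $M_1$ and $M_2$ have precisely the same ladders.
   Context: Toroidal polyhex: consider the regular hexagonal lattice in the plane with one of its three edge-directions vertical. Use affine coordinates with origin at the centre of a hexagon, horizontal $x$-axis, $y$-axis at angle $60^\circ$ to it, and unit length the distance between two parallel edges of a hexagon, so that hexagon centres are exactly the integer points. For integers $p,q\ge 2$ and $t$, $H(p,q,t)$ is obtained from the $p\times q$-parallelogram $P$ with corners $(0,0),(p,0),(p,q),(0,q)$ by identifying its two lateral sides and then identifying its top side with its bottom side after a twist of $t$ hexagons; equivalently, it is the quotient of the hexagonal lattice by the translation group generated by $(p,0)$ and $(t,q)$. It is a cubic bipartite graph embedded in the torus with all faces hexagons; fix a proper black/white vertex colouring. Winding vector: an oriented closed curve on the torus has winding vector $(m,n)\in\mathbb Z^2$ if a lift to the plane has displacement $m(p,0)+n(t,q)$. Resonance graph: $R_6(H)$ has the perfect matchings of $H$ as vertices, two being adjacent iff their symmetric difference is exactly the set of six edges of a hexagonal face of $H$. Cut cycles and flow: the dual graph has a vertex at the centre of each hexagon, and for each edge $e$ of $H$ a dual edge $e^*$ joining the centres of the two hexagons sharing $e$ and crossing only $e$. $L_x$ (resp. $L_y$) is any oriented cycle of the dual graph winding once around in the $x$-axis (resp. $y$-axis)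 direction, i.e. with winding vector $\pm(1,0)$ (resp. $\pm(0,1)$). For $L\in\{L_x,L_y\}$ let $L^*$ be the set of edges of $H$ crossed by $L$, and let $(L^* )^+$ (resp. $(L^* )^-$) be the set of $e\in L^*$ whose white end-vertex is on the left (resp. right) side of $L$. For a perfect matching $M$, ${\rm flow}_L(H,M)=|(L^* )^+\cap M|-|(L^* )^-\cap M|$. Ladders: the edges of $H$ have three edge-directions (parallel classes of lattice edges). A zigzag cycle is a cycle whose edges have only two edge-directions, appearing alternately along the cycle. A ladder of a perfect matching $M$ is an $M$-alternating zigzag cycle (its edges are alternately in $M$ and not in $M$). A ladder is considered together with its matching edges: $M_1,M_2$ have precisely the same ladders if, for every zigzag cycle $Z$, $Z$ is $M_1$-alternating iff it is $M_2$-alternating, and in that case $M_1\cap E(Z)=M_2\cap E(Z)$. *)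

theory Defs
  imports "HOL-Library.Product_Plus"
begin

section \<open>The hexagonal lattice\<close>

text \<open>Points are given in the affine coordinates in which the hexagon centres are the integer
  points and the y-axis is at angle 60 degrees to the x-axis. A vertex of the lattice lies on three
  mutually adjacent hexagons, with centres \<open>a\<close>, \<open>b\<close>, \<open>c\<close> say, and its position is
  \<open>(a + b + c) / 3\<close>. To stay within the integers, coordinates of vertices (but not of hexagon
  centres) are scaled by 3, so this vertex is represented by the point \<open>a + b + c\<close>.\<close>

type_synonym point = "int \<times> int"

definition unit_steps :: "point set" where
  "unit_steps = {(1,0), (0,1), (-1,1), (-1,0), (0,-1), (1,-1)}"

text \<open>Rotation of a vector by 60 degrees counterclockwise and clockwise.\<close>

definition rot_left :: "point \<Rightarrow> point" where
  "rot_left v = (- snd v, fst v + snd v)"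

definition rot_right :: "point \<Rightarrow> point" where
  "rot_right v = (fst v + snd v, - fst v)"

text \<open>Let \<open>c\<close> and \<open>d\<close> be the centres of two adjacent hexagons. The end-vertices of their common edge
  are the centroids of the two triangles of hexagon centres erected on the segment from \<open>c\<close> to \<open>d\<close>;
  they lie on its left and on its right.\<close>

definition left_end :: "point \<Rightarrow> point \<Rightarrow> point" where
  "left_end c d = c + d + (c + rot_left (d - c))"

definition right_end :: "point \<Rightarrow> point \<Rightarrow> point" where
  "right_end c d = c + d + (c + rot_right (d - c))"


section \<open>The toroidal polyhex\<close>

definition translation_group :: "int \<Rightarrow> int \<Rightarrow> int \<Rightarrow> point set" where
  "translation_group p q t = {(m * p + n * t, n * q) | m n. True}"

definition torus_hexagon :: "int \<Rightarrow> int \<Rightarrow> int \<Rightarrow> point \<Rightarrow> point set" where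
  "torus_hexagon p q t c = {c + (x, y) | x y. (x, y) \<in> translation_group p q t}"

text \<open>A vertex of the toroidal polyhex is an orbit of lattice vertices. The factor 3 is due to the
  scaling of vertex coordinates.\<close>

definition torus_vertex :: "int \<Rightarrow> int \<Rightarrow> int \<Rightarrow> point \<Rightarrow> point set" where
  "torus_vertex p q t v = {v + (3 * x, 3 * y) | x y. (x, y) \<in> translation_group p q t}"

text \<open>The edge crossed by the dual edge from \<open>c\<close> to \<open>d\<close>. For \<open>p, q \<ge> 2\<close> the quotient graph has
  no loops and no parallel edges, so an edge may be identified with the set of its two ends.\<close>

definition crossed_edge :: "int \<Rightarrow> int \<Rightarrow> int \<Rightarrow> point \<Rightarrow> point \<Rightarrow> point set set" where
  "crossed_edge p q t c d =
     {torus_vertex p q t (left_end c d), torus_vertex p q t (right_end c d)}"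

definition polyhex_verts :: "int \<Rightarrow> int \<Rightarrow> int \<Rightarrow> point set set" where
  "polyhex_verts p q t = {torus_vertex p q t (left_end c d) | c d. d - c \<in> unit_steps}"

definition polyhex_edges :: "int \<Rightarrow> int \<Rightarrow> int \<Rightarrow> point set set set" where
  "polyhex_edges p q t = {crossed_edge p q t c d | c d. d - c \<in> unit_steps}"

definition hexagon_edges :: "int \<Rightarrow> int \<Rightarrow> int \<Rightarrow> point \<Rightarrow> point set set set" where
  "hexagon_edges p q t c = {crossed_edge p q t c d | d. d - c \<in> unit_steps}"


section \<open>Perfect matchings and the resonance graph\<close>

definition perfect_matching :: "'v set \<Rightarrow> 'v set set \<Rightarrow> 'v set set \<Rightarrow> bool" where
  "perfect_matching V E M \<longleftrightarrow> M \<subseteq> E \<and> (\<forall>v\<in>V. \<exists>!e. e \<in> M \<and> v \<in> e)"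

definition proper_colouring :: "'v set set \<Rightarrow> ('v \<Rightarrow> bool) \<Rightarrow> bool" where
  "proper_colouring E white \<longleftrightarrow> (\<forall>u v. {u, v} \<in> E \<longrightarrow> white u \<noteq> white v)"

definition polyhex_matching :: "int \<Rightarrow> int \<Rightarrow> int \<Rightarrow> point set set set \<Rightarrow> bool" where
  "polyhex_matching p q t M \<longleftrightarrow> perfect_matching (polyhex_verts p q t) (polyhex_edges p q t) M"

text \<open>The (symmetric) adjacency relation of the resonance graph, whose vertices are the perfect
  matchings. Two perfect matchings are in the same connected component iff they are related by
  its reflexive transitive closure.\<close>

definition resonance_adj ::
    "int \<Rightarrow> int \<Rightarrow> int \<Rightarrow> (point set set set \<times> point set set set) set" where
  "resonance_adj p q t =
     {(M, N). polyhex_matching p q t M \<and> polyhex_matching p q t N \<and>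
              (\<exists>c. sym_diff M N = hexagon_edges p q t c)}"


section \<open>Cut cycles and flow\<close>

text \<open>An oriented cycle of the dual graph is given by a lift to the plane, that is, by the list
  of consecutive hexagon centres along the lift; the last entry is a translate of the first one.
  The dual graph may have parallel edges, so besides repeated vertices also repeated edges are
  excluded.\<close>

definition dual_cycle :: "int \<Rightarrow> int \<Rightarrow> int \<Rightarrow> point list \<Rightarrow> bool" where
  "dual_cycle p q t L \<longleftrightarrow>
     length L \<ge> 2 \<and>
     (\<forall>i. Suc i < length L \<longrightarrow> L ! Suc i - L ! i \<in> unit_steps) \<and>
     last L - hd L \<in> translation_group p q t \<and>
     distinct (map (torus_hexagon p q t) (butlast L)) \<and>
     distinct (map (\<lambda>i. crossed_edge p q t (L ! i) (L ! Suc i)) [0..<length L - 1])"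

definition has_winding_vector ::
    "int \<Rightarrow> int \<Rightarrow> int \<Rightarrow> point list \<Rightarrow> int \<Rightarrow> int \<Rightarrow> bool" where
  "has_winding_vector p q t L m n \<longleftrightarrow> last L - hd L = (m * p + n * t, n * q)"

definition cut_cycle_x :: "int \<Rightarrow> int \<Rightarrow> int \<Rightarrow> point list \<Rightarrow> bool" where
  "cut_cycle_x p q t L \<longleftrightarrow> dual_cycle p q t L \<and>
     (has_winding_vector p q t L 1 0 \<or> has_winding_vector p q t L (-1) 0)"

definition cut_cycle_y :: "int \<Rightarrow> int \<Rightarrow> int \<Rightarrow> point list \<Rightarrow> bool" where
  "cut_cycle_y p q t L \<longleftrightarrow> dual_cycle p q t L \<and>
     (has_winding_vector p q t L 0 1 \<or> has_winding_vector p q t L 0 (-1))"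

definition cut_plus ::
    "int \<Rightarrow> int \<Rightarrow> int \<Rightarrow> (point set \<Rightarrow> bool) \<Rightarrow> point list \<Rightarrow> point set set set" where
  "cut_plus p q t white L =
     {crossed_edge p q t (L ! i) (L ! Suc i) | i.
        Suc i < length L \<and> white (torus_vertex p q t (left_end (L ! i) (L ! Suc i)))}"

definition cut_minus ::
    "int \<Rightarrow> int \<Rightarrow> int \<Rightarrow> (point set \<Rightarrow> bool) \<Rightarrow> point list \<Rightarrow> point set set set" where
  "cut_minus p q t white L =
     {crossed_edge p q t (L ! i) (L ! Suc i) | i.
        Suc i < length L \<and> white (torus_vertex p q t (right_end (L ! i) (L ! Suc i)))}"

definition flow ::
    "int \<Rightarrow> int \<Rightarrow> int \<Rightarrow> (point set \<Rightarrow> bool) \<Rightarrow> point list \<Rightarrow> point set set set \<Rightarrow> int" where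
  "flow p q t white L M =
     int (card (cut_plus p q t white L \<inter> M)) - int (card (cut_minus p q t white L \<inter> M))"


section \<open>Zigzag cycles and ladders\<close>

text \<open>A cycle of a simple graph is given by the list of its vertices; \<open>cyc_edge Z i\<close> is its
  \<open>i\<close>-th edge, with indices taken modulo the length.\<close>

definition cyc_edge :: "'v list \<Rightarrow> nat \<Rightarrow> 'v set" where
  "cyc_edge Z i = {Z ! (i mod length Z), Z ! (Suc i mod length Z)}"

definition cyc_edges :: "'v list \<Rightarrow> 'v set set" where
  "cyc_edges Z = {cyc_edge Z i | i. i < length Z}"

definition graph_cycle :: "'v set set \<Rightarrow> 'v list \<Rightarrow> bool" where
  "graph_cycle E Z \<longleftrightarrow> length Z \<ge> 3 \<and> distinct Z \<and> cyc_edges Z \<subseteq> E"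

text \<open>The lattice edges crossed by dual edges parallel to a given unit step are perpendicular to
  it, so they form a parallel class.\<close>

definition direction_class :: "int \<Rightarrow> int \<Rightarrow> int \<Rightarrow> point \<Rightarrow> point set set set" where
  "direction_class p q t s = {crossed_edge p q t c (c + s) | c. True}"

definition edge_directions :: "int \<Rightarrow> int \<Rightarrow> int \<Rightarrow> point set set set set" where
  "edge_directions p q t = direction_class p q t ` {(1,0), (0,1), (-1,1)}"

definition zigzag_cycle :: "int \<Rightarrow> int \<Rightarrow> int \<Rightarrow> point set list \<Rightarrow> bool" where
  "zigzag_cycle p q t Z \<longleftrightarrow>
     graph_cycle (polyhex_edges p q t) Z \<and>
     (\<exists>A\<in>edge_directions p q t. \<exists>B\<in>edge_directions p q t. A \<noteq> B \<and>
        (\<forall>i<length Z. cyc_edge Z i \<in> A \<and> cyc_edge Z (Suc i) \<in> B \<or>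
                      cyc_edge Z i \<in> B \<and> cyc_edge Z (Suc i) \<in> A))"

definition alternating_cycle :: "'v set set \<Rightarrow> 'v list \<Rightarrow> bool" where
  "alternating_cycle M Z \<longleftrightarrow>
     (\<forall>i<length Z. cyc_edge Z i \<in> M \<longleftrightarrow> cyc_edge Z (Suc i) \<notin> M)"

definition is_ladder :: "int \<Rightarrow> int \<Rightarrow> int \<Rightarrow> point set set set \<Rightarrow> point set list \<Rightarrow> bool" where
  "is_ladder p q t M Z \<longleftrightarrow> zigzag_cycle p q t Z \<and> alternating_cycle M Z"

definition same_ladders ::
    "int \<Rightarrow> int \<Rightarrow> int \<Rightarrow> point set set set \<Rightarrow> point set set set \<Rightarrow> bool" where
  "same_ladders p q t M N \<longleftrightarrow>
     (\<forall>Z. zigzag_cycle p q t Z \<longrightarrow>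
        (is_ladder p q t M Z \<longleftrightarrow> is_ladder p q t N Z) \<and>
        (is_ladder p q t M Z \<longrightarrow> M \<inter> cyc_edges Z = N \<inter> cyc_edges Z))"

end

theory Submission
  imports Defs
begin

text \<open>
  A perfect matching is compared with another one through a height function. Orient every dual edge
  so that it crosses its lattice edge with the up-triangle vertex on its left; these dual arcs point
  in three directions at mutual angles of 120 degrees. Every vertex meets exactly one matching edge,
  so for two perfect matchings \<open>M\<close> and \<open>N\<close> the function on arcs \<open>[e
  \<in> M] - [e \<in> N]\<close> sums to zero around each triangle of the dual lattice, and hence is
  the difference of a potential \<open>h\<close> on the hexagon centres in the plane
  (\<open>exists_potential\<close>). The difference of the flows across a cut cycle is, up to a
  sign, the increment of \<open>h\<close> along the cycle (\<open>flow_diff\<close>). So the flows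
  of \<open>M\<close> and \<open>N\<close> across \<open>L\<^sub>x\<close> and
  \<open>L\<^sub>y\<close> agree iff \<open>h\<close> is a function on the torus.

  Connected matchings share flow and ladders for the following reasons. When \<open>M\<close> and
  \<open>N\<close> differ by one hexagon, \<open>h\<close> is, up to a constant, plus or minus the
  indicator of that hexagon (\<open>resonance_adj_height\<close>), so the flows agree. A ladder
  covers its vertices by its own matching edges, so no vertex on it is matched in the third
  direction. A hexagon that shares an edge with the ladder has both its edges of the third direction
  touching the ladder, so it contains no matching edge of that direction and cannot be flipped
  (\<open>ladder_avoids_flip\<close>). Thus flips leave every ladder as it is.

  Conversely, let \<open>M\<close> and \<open>N\<close> have equal flows and the same ladders. Now
  \<open>h\<close> lives on the torus; take it to be nonnegative, and if it is not constant,
  consider the hexagons where it attains its maximum. If \<open>M\<close> contains the three edges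
  through which arcs enter such a hexagon, then flipping it lowers \<open>h\<close> at this hexagon
  by one, and induction on the sum of \<open>h\<close> applies
  (\<open>connected_of_potential\<close>). Otherwise every maximal hexagon is entered by an arc that
  crosses no edge of \<open>M\<close>, and then the tail of this arc is maximal as well. Walking
  backwards along such arcs must eventually return to the same hexagon of the torus. The flow of
  \<open>M\<close> across this closed walk is zero; since flow depends only on the homology class,
  it is zero across all translates of the walk too, and as all arcs count positively,
  \<open>M\<close> contains no edge at all of the directions that occur
  (\<open>blocked_imp_missing\<close>). If \<open>M\<close> omits one direction altogether, then all
  zigzag cycles in the other two directions are ladders of \<open>M\<close>, and they cover
  \<open>M\<close>. So \<open>N\<close>, having the same ladders, is equal to \<open>M\<close>
  (\<open>missing_direction_determined\<close>).
\<close>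

section \<open>Directions of dual arcs\<close>

text \<open>Points are calculated with as vectors, so quantifiers over them are not split into
  coordinates.\<close>

declare split_paired_Ex [simp del] split_paired_All [simp del]

text \<open>The three directions in which a dual arc has the vertex of an up-triangle on its left.
  Every lattice edge is crossed by exactly one such arc, so pairs of a hexagon centre and a
  direction parametrize the edges.\<close>

datatype dir = East | Northwest | Southwest

lemma UNIV_dir: "(UNIV :: dir set) = {East, Northwest, Southwest}"
  by (auto intro: dir.exhaust)

instance dir :: finite
  by standard (simp add: UNIV_dir)

lemma sum_dir: "(\<Sum>s\<in>UNIV. f s) = f East + f Northwest + f Southwest"
  for f :: "dir \<Rightarrow> int"
  by (simp add: UNIV_dir)

lemma all_dir: "(\<forall>s. P s) \<longleftrightarrow> P East \<and> P Northwest \<and> P Southwest"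
  by (metis dir.exhaust)

lemma ex_dir: "(\<exists>s. P s) \<longleftrightarrow> P East \<or> P Northwest \<or> P Southwest"
  by (metis dir.exhaust)

fun step :: "dir \<Rightarrow> point" where
  "step East = (1, 0)"
| "step Northwest = (-1, 1)"
| "step Southwest = (0, -1)"

text \<open>Rotation by 120 degrees counterclockwise.\<close>

fun turn :: "dir \<Rightarrow> dir" where
  "turn East = Northwest"
| "turn Northwest = Southwest"
| "turn Southwest = East"

text \<open>The hexagon centres \<open>u\<close>, \<open>u + (1,0)\<close>, \<open>u + (0,1)\<close>
  form the up-triangle of \<open>u\<close>, and \<open>v + (1,0)\<close>, \<open>v + (0,1)\<close>,
  \<open>v + (1,1)\<close> the down-triangle of \<open>v\<close>. The arc of direction
  \<open>s\<close> leaving \<open>x\<close> has the up-triangle of \<open>x + lft s\<close> on its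
  left and the down-triangle of \<open>x + rgt s\<close> on its right.\<close>

fun lft :: "dir \<Rightarrow> point" where
  "lft East = (0, 0)"
| "lft Northwest = (-1, 0)"
| "lft Southwest = (0, -1)"

fun rgt :: "dir \<Rightarrow> point" where
  "rgt East = (0, -1)"
| "rgt Northwest = (-1, 0)"
| "rgt Southwest = (-1, -1)"

lemma turn_distinct [simp]: "turn s \<noteq> s" "s \<noteq> turn s" "turn (turn s) \<noteq> s" "s \<noteq> turn (turn s)"
  by (cases s; simp)+

lemma turn_cube [simp]: "turn (turn (turn s)) = s"
  by (cases s) auto

lemma turn_exhaust: "r = s \<or> r = turn s \<or> r = turn (turn s)"
  by (cases s; cases r) auto

lemma third_direction: "(a :: dir) \<noteq> b \<Longrightarrow> \<exists>r. r \<noteq> a \<and> r \<noteq> b \<and> (\<forall>s. s = a \<or> s = b \<or> s = r)"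
  by (cases a; cases b) (auto simp: ex_dir all_dir)

lemma sum_dir_turn: "(\<Sum>r\<in>UNIV. f r) = f s + f (turn s) + f (turn (turn s))"
  for f :: "dir \<Rightarrow> int"
  by (cases s) (simp_all add: sum_dir)

lemma step_turn_turn: "step (turn (turn s)) = - step s - step (turn s)"
  by (cases s) (simp_all add: zero_prod_def)

text \<open>On the boundary of an up-triangle, traversed counterclockwise, the arc of direction
  \<open>s\<close> is followed by the one of direction \<open>turn s\<close>; on the boundary of a
  down-triangle, traversed clockwise, it is the other way round.\<close>

lemma lft_turn: "lft (turn s) = lft s - step s"
  by (cases s) (auto simp: zero_prod_def)

lemma rgt_turn: "rgt (turn s) = rgt s + step (turn s)"
  by (cases s) (auto simp: zero_prod_def)

text \<open>Walking from an up-vertex along the edge crossed in direction \<open>turn s\<close> and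
  then along the edge crossed in direction \<open>turn (turn s)\<close> leads to the up-vertex that
  lies one step \<open>s\<close> further along the zigzag.\<close>

lemma turn_shift: "lft (turn (turn s)) - rgt (turn (turn s)) = lft (turn s) - rgt (turn s) + step s"
  by (cases s) (auto simp: zero_prod_def)

lemma unit_steps_dir: "v \<in> unit_steps \<longleftrightarrow> (\<exists>s. v = step s \<or> v = - step s)"
  by (auto simp: unit_steps_def ex_dir)

definition times_step :: "nat \<Rightarrow> dir \<Rightarrow> point" where
  "times_step i s = (int i * fst (step s), int i * snd (step s))"

lemma times_step_simps [simp]: "times_step 0 s = 0" "times_step (Suc i) s = times_step i s + step s"
  by (simp_all add: times_step_def zero_prod_def algebra_simps prod_eq_iff)

lemma times_step_add: "times_step (i + j) s = times_step i s + times_step j s"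
  by (simp add: times_step_def algebra_simps)

lemma point_induct [case_names origin forward backward]:
  assumes "P 0" "\<And>x s. P x \<Longrightarrow> P (x + step s)" "\<And>x s. P x \<Longrightarrow> P (x - step s)"
  shows "P (x :: point)"
proof (cases x)
  case (Pair i j)
  have 1: "P (i, 0)"
  proof (induction i rule: int_induct[of _ 0])
    case base show ?case using assms(1) by (simp add: zero_prod_def)
  next
    case (step1 i) then show ?case using assms(2)[of "(i, 0)" East] by simp
  next
    case (step2 i) then show ?case using assms(3)[of "(i, 0)" East] by simp
  qed
  have "P (i, j)"
  proof (induction j rule: int_induct[of _ 0])
    case base show ?case by (rule 1)
  next
    case (step1 j) then show ?case using assms(3)[of "(i, j)" Southwest] by simp
  next
    case (step2 j) then show ?case using assms(2)[of "(i, j)" Southwest] by simp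
  qed
  with Pair show ?thesis by simp
qed

section \<open>Potentials on the hexagon centres\<close>

text \<open>The two sums run along the boundaries of an up-triangle and a down-triangle. A function
  on arcs with this property is a closed discrete 1-form on the triangular dual lattice.\<close>

definition curl_free :: "(point \<Rightarrow> dir \<Rightarrow> int) \<Rightarrow> bool" where
  "curl_free k \<longleftrightarrow> (\<forall>u. (\<Sum>s\<in>UNIV. k (u - lft s) s) = 0) \<and> (\<forall>v. (\<Sum>s\<in>UNIV. k (v - rgt s) s) = 0)"

definition potential :: "(point \<Rightarrow> dir \<Rightarrow> int) \<Rightarrow> (point \<Rightarrow> int) \<Rightarrow> bool" where
  "potential k h \<longleftrightarrow> (\<forall>x s. h (x + step s) = h x + k x s)"

lemma int_antiderivative: "\<exists>g. \<forall>i. g (i + 1) = g i + f i" for f :: "int \<Rightarrow> int"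
proof
  define g where "g i = (\<Sum>k\<in>{0..<i}. f k) - (\<Sum>k\<in>{i..<0}. f k)" for i :: int
  show "\<forall>i. g (i + 1) = g i + f i"
  proof
    fix i :: int
    consider (nonneg) "i \<ge> 0" | (neg) "i < 0" by linarith
    then show "g (i + 1) = g i + f i"
    proof cases
      case nonneg
      then have "{0..<i + 1} = insert i {0..<i}" "{i + 1..<0} = {}" "{i..<0} = {}" by auto
      then show ?thesis by (simp add: g_def)
    next
      case neg
      then have "{i..<0} = insert i {i + 1..<0}" "{0..<i + 1} = {}" "{0..<i} = {}" by auto
      then show ?thesis by (simp add: g_def)
    qed
  qed
qed

text \<open>The discrete Poincare lemma for the plane. A potential is obtained by integrating along
  the row through the origin and then along columns; the two triangles that make up each unit square
  make the result independent of the order of rows and columns.\<close>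

lemma exists_potential:
  assumes "curl_free k"
  shows "\<exists>h. potential k h"
proof -
  \<comment> \<open>The increments of the potential for the steps \<open>(1, 0)\<close> and \<open>(0, 1)\<close>.\<close>
  define a where "a i j = k (i, j) East" for i j
  define b where "b i j = - k (i, j + 1) Southwest" for i j
  have up_tri: "k (i, j) East + k (i + 1, j) Northwest + k (i, j + 1) Southwest = 0" for i j
    using assms unfolding curl_free_def by (auto simp: sum_dir dest!: spec[of _ "(i, j)"])
  have dn_tri: "k (i, j + 1) East + k (i + 1, j) Northwest + k (i + 1, j + 1) Southwest = 0" for i j
    using assms unfolding curl_free_def by (auto simp: sum_dir dest!: spec[of _ "(i, j)"])
  have comm: "a i j + b (i + 1) j = b i j + a i (j + 1)" for i j
    using up_tri[of i j] dn_tri[of i j] by (simp add: a_def b_def)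
  \<comment> \<open>\<open>r\<close> integrates \<open>k\<close> along the row through the origin, \<open>c i\<close> along the column at \<open>i\<close>.\<close>
  obtain r where r: "\<And>i. r (i + 1) = r i + a i 0" using int_antiderivative[of "\<lambda>i. a i 0"] by blast
  obtain c where c: "\<And>i j. c i (j + 1) = c i j + b i j"
    using int_antiderivative[of "b _"] by metis
  define h where "h i j = r i + c i j - c i 0" for i j
  have hb: "h i (j + 1) = h i j + b i j" for i j by (simp add: h_def c)
  have ha: "h (i + 1) j = h i j + a i j" for i j
  proof (induction j rule: int_induct[of _ 0])
    case base show ?case by (simp add: h_def r)
  next
    case (step1 j) then show ?case using comm[of i j] by (simp add: hb)
  next
    case (step2 j)
    then show ?case using comm[of i "j - 1"] hb[of i "j - 1"] hb[of "i + 1" "j - 1"] by simp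
  qed
  have "(\<lambda>(i, j). h i j) (x + step s) = (\<lambda>(i, j). h i j) x + k x s" for x s
  proof (cases x)
    case (Pair i j)
    show ?thesis
    proof (cases s)
      case East then show ?thesis using Pair ha[of i j] by (simp add: a_def)
    next
      case Northwest
      then show ?thesis using Pair ha[of "i - 1" j] hb[of "i - 1" j] up_tri[of "i - 1" j]
        by (simp add: a_def b_def)
    next
      case Southwest then show ?thesis using Pair hb[of i "j - 1"] by (simp add: b_def)
    qed
  qed
  then show ?thesis unfolding potential_def by blast
qed

lemma potential_imp_curl_free:
  assumes "potential k h" shows "curl_free k"
proof -
  have k: "k x s = h (x + step s) - h x" for x s
    using assms unfolding potential_def by (metis add_diff_cancel_left')
  have "(\<Sum>s\<in>UNIV. k (u - lft s) s) = 0" for u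
    by (cases u) (simp add: sum_dir k)
  moreover have "(\<Sum>s\<in>UNIV. k (v - rgt s) s) = 0" for v
    by (cases v) (simp add: sum_dir k)
  ultimately show ?thesis unfolding curl_free_def by blast
qed

text \<open>The increment of a potential over a period is the same from every starting point: this
  is the homological invariance of flow.\<close>

lemma potential_quasi_periodic:
  assumes h: "potential k h" and per: "\<And>x s. k (x + g) s = k x s"
  shows "h (x + g) - h x = h g - h 0"
proof (induction x rule: point_induct)
  case (forward x s)
  then show ?case using h per[of x s] unfolding potential_def by (metis (no_types, opaque_lifting) add.assoc add.commute add_diff_cancel_left)
next
  case (backward x s)
  have "h (x - step s + g + step s) = h (x - step s + g) + k (x - step s + g) s"
    "h (x - step s + step s) = h (x - step s) + k (x - step s) s"
    using h unfolding potential_def by blast+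
  with backward per[of "x - step s" s] show ?case by (simp add: algebra_simps)
qed simp

section \<open>The period lattice, vertices and edges\<close>

lemma crossed_edge_commute: "crossed_edge p q t c d = crossed_edge p q t d c"
  by (cases c; cases d)
     (auto simp: crossed_edge_def left_end_def right_end_def rot_left_def rot_right_def algebra_simps)

locale polyhex =
  fixes p q t :: int
  assumes p_ge: "p \<ge> 2" and q_ge: "q \<ge> 2"
begin

abbreviation G :: "point set" where "G \<equiv> translation_group p q t"

lemma zero_G [simp]: "0 \<in> G" "(0, 0) \<in> G"
proof -
  show "(0, 0) \<in> G" unfolding translation_group_def by (rule CollectI) (rule exI[of _ 0], rule exI[of _ 0], simp)
  then show "0 \<in> G" by (simp add: zero_prod_def)
qed

lemma add_G:
  assumes "x \<in> G" "y \<in> G" shows "x + y \<in> G"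
proof -
  obtain a b c d where "x = (a * p + b * t, b * q)" "y = (c * p + d * t, d * q)"
    using assms unfolding translation_group_def by blast
  then have "x + y = ((a + c) * p + (b + d) * t, (b + d) * q)"
    by (simp add: algebra_simps)
  then show ?thesis unfolding translation_group_def by blast
qed

lemma uminus_G_iff [simp]: "- x \<in> G \<longleftrightarrow> x \<in> G"
proof -
  have *: "- x \<in> G" if "x \<in> G" for x
  proof -
    obtain a b where "x = (a * p + b * t, b * q)"
      using \<open>x \<in> G\<close> unfolding translation_group_def by blast
    then have "- x = ((- a) * p + (- b) * t, (- b) * q)"
      by (simp add: algebra_simps)
    then show ?thesis unfolding translation_group_def by blast
  qed
  from *[of x] *[of "- x"] show ?thesis by auto
qed

lemma diff_G: "x \<in> G \<Longrightarrow> y \<in> G \<Longrightarrow> x - y \<in> G"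
  using add_G[of x "- y"] by simp

lemma diff_G_commute: "x - y \<in> G \<longleftrightarrow> y - x \<in> G"
  using uminus_G_iff[of "x - y"] by simp

text \<open>Since \<open>p\<close> and \<open>q\<close> are at least 2, hexagons whose centres
  differ by at most one in each coordinate stay distinct on the torus. This is what makes the
  quotient graph simple.\<close>

lemma not_in_G:
  assumes "x \<noteq> 0" "\<bar>fst x\<bar> \<le> 1" "\<bar>snd x\<bar> \<le> 1"
  shows "x \<notin> G"
proof
  assume "x \<in> G"
  then obtain m n where x: "fst x = m * p + n * t" "snd x = n * q"
    unfolding translation_group_def by auto
  have "n = 0"
  proof (rule ccontr)
    assume "n \<noteq> 0"
    then have "1 * 2 \<le> \<bar>n\<bar> * \<bar>q\<bar>" using q_ge by (intro mult_mono) auto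
    with x(2) assms(3) show False by (simp add: abs_mult)
  qed
  have "m = 0"
  proof (rule ccontr)
    assume "m \<noteq> 0"
    then have "1 * 2 \<le> \<bar>m\<bar> * \<bar>p\<bar>" using p_ge by (intro mult_mono) auto
    with x(1) \<open>n = 0\<close> assms(2) show False by (simp add: abs_mult)
  qed
  with x \<open>n = 0\<close> have "x = 0" by (simp add: prod_eq_iff)
  with assms(1) show False by simp
qed

lemma step_not_in_G [simp]: "step s \<notin> G" "- step s \<notin> G"
proof -
  show "step s \<notin> G" by (rule not_in_G; cases s) (auto simp: zero_prod_def)
  then show "- step s \<notin> G" by simp
qed

text \<open>Already \<open>p * q\<close> steps in any direction form a period.\<close>

lemma step_finite_order: "\<exists>n>0. times_step n s \<in> G"
proof (intro exI conjI)
  obtain a b where ab: "step s = (a, b)" by fastforce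
  have pq: "p * q > 0" using p_ge q_ge by simp
  then show "nat (p * q) > 0" by simp
  have "times_step (nat (p * q)) s = ((a * q - b * t) * p + (b * p) * t, (b * p) * q)"
    using pq by (simp add: times_step_def ab algebra_simps)
  then show "times_step (nat (p * q)) s \<in> G" unfolding translation_group_def by blast
qed

definition fundamental_domain :: "point set" where "fundamental_domain = {0..<p} \<times> {0..<q}"

lemma fundamental_domain: "finite fundamental_domain" "\<exists>y\<in>fundamental_domain. x - y \<in> G"
proof -
  show "finite fundamental_domain" by (simp add: fundamental_domain_def)
  obtain a b where x: "x = (a, b)" by fastforce
  define n m where "n = b div q" and "m = (a - n * t) div p"
  have "b - n * q = b mod q" "a - n * t - m * p = (a - n * t) mod p"
    unfolding n_def m_def by (simp_all add: minus_div_mult_eq_mod)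
  then have "(a - n * t - m * p, b - n * q) \<in> fundamental_domain" using p_ge q_ge by (simp add: fundamental_domain_def)
  moreover have "x - (a - n * t - m * p, b - n * q) = (m * p + n * t, n * q)" by (simp add: x)
  then have "x - (a - n * t - m * p, b - n * q) \<in> G" unfolding translation_group_def by blast
  ultimately show "\<exists>y\<in>fundamental_domain. x - y \<in> G" by blast
qed

text \<open>The torus vertices given by the up-triangle and the down-triangle of a point. The
  offsets \<open>(1, 1)\<close> and \<open>(2, 2)\<close> are the sums of the corners of the two
  triangles of the origin; modulo 3 they tell the two kinds apart.\<close>

definition up :: "point \<Rightarrow> point set" where
  "up u = torus_vertex p q t (u + u + u + (1, 1))"

definition dn :: "point \<Rightarrow> point set" where
  "dn v = torus_vertex p q t (v + v + v + (2, 2))"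

definition edge :: "point \<Rightarrow> dir \<Rightarrow> point set set" where
  "edge x s = crossed_edge p q t x (x + step s)"

lemma torus_vertex_iff: "w \<in> torus_vertex p q t v \<longleftrightarrow> (\<exists>g\<in>G. w = v + g + g + g)"
  by (cases v; cases w) (force simp: torus_vertex_def)

lemma torus_vertex_eq_iff:
  "torus_vertex p q t v = torus_vertex p q t w \<longleftrightarrow> (\<exists>g\<in>G. w = v + g + g + g)"
proof
  assume "torus_vertex p q t v = torus_vertex p q t w"
  moreover have "w \<in> torus_vertex p q t w" unfolding torus_vertex_iff by (intro bexI[of _ 0]) auto
  ultimately show "\<exists>g\<in>G. w = v + g + g + g" using torus_vertex_iff by blast
next
  assume "\<exists>g\<in>G. w = v + g + g + g"
  then obtain g where g: "g \<in> G" "w = v + g + g + g" by blast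
  show "torus_vertex p q t v = torus_vertex p q t w"
  proof (intro set_eqI iffI)
    fix z assume "z \<in> torus_vertex p q t v"
    then obtain k where "k \<in> G" "z = v + k + k + k" unfolding torus_vertex_iff by blast
    with g have "k - g \<in> G" "z = w + (k - g) + (k - g) + (k - g)"
      by (auto intro: diff_G simp: algebra_simps)
    then show "z \<in> torus_vertex p q t w" unfolding torus_vertex_iff by blast
  next
    fix z assume "z \<in> torus_vertex p q t w"
    then obtain k where "k \<in> G" "z = w + k + k + k" unfolding torus_vertex_iff by blast
    with g have "k + g \<in> G" "z = v + (k + g) + (k + g) + (k + g)"
      by (auto intro: add_G simp: algebra_simps)
    then show "z \<in> torus_vertex p q t v" unfolding torus_vertex_iff by blast
  qed
qed

lemma up_eq_iff [simp]: "up u = up u' \<longleftrightarrow> u - u' \<in> G"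
proof -
  have "(u' + u' + u' + (1, 1) = u + u + u + (1, 1) + g + g + g) \<longleftrightarrow> g = u' - u" for g :: point
    by (cases u; cases u'; cases g) auto
  then show ?thesis unfolding up_def torus_vertex_eq_iff by (metis diff_G_commute)
qed

lemma dn_eq_iff [simp]: "dn u = dn u' \<longleftrightarrow> u - u' \<in> G"
proof -
  have "(u' + u' + u' + (2, 2) = u + u + u + (2, 2) + g + g + g) \<longleftrightarrow> g = u' - u" for g :: point
    by (cases u; cases u'; cases g) auto
  then show ?thesis unfolding dn_def torus_vertex_eq_iff by (metis diff_G_commute)
qed

lemma up_neq_dn [simp]: "up u \<noteq> dn v" "dn v \<noteq> up u"
proof -
  have "v + v + v + (2, 2) \<noteq> u + u + u + (1, 1) + g + g + g" for g :: point
  proof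
    assume "v + v + v + (2, 2) = u + u + u + (1, 1) + g + g + g"
    then have "fst (v + v + v + (2, 2)) = fst (u + u + u + (1, 1) + g + g + g)" by simp
    then have "3 * (fst u + fst g - fst v) = 1" by simp
    then show False by presburger
  qed
  then show "up u \<noteq> dn v" unfolding up_def dn_def torus_vertex_eq_iff by blast
  then show "dn v \<noteq> up u" by simp
qed

lemma left_end_arc: "torus_vertex p q t (left_end x (x + step s)) = up (x + lft s)"
  unfolding up_def
  by (rule arg_cong[of _ _ "torus_vertex p q t"], cases x, cases s)
     (auto simp: left_end_def rot_left_def)

lemma right_end_arc: "torus_vertex p q t (right_end x (x + step s)) = dn (x + rgt s)"
  unfolding dn_def
  by (rule arg_cong[of _ _ "torus_vertex p q t"], cases x, cases s)
     (auto simp: right_end_def rot_right_def)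

lemma left_right_swap: "left_end (x + step s) x = right_end x (x + step s)"
  "right_end (x + step s) x = left_end x (x + step s)"
  by (cases x; cases s; simp add: left_end_def right_end_def rot_left_def rot_right_def)+

lemma edge_ends: "edge x s = {up (x + lft s), dn (x + rgt s)}"
  unfolding edge_def crossed_edge_def left_end_arc right_end_arc ..

text \<open>The offset between the two ends of an edge determines its direction, because the offsets
  of different directions differ by a unit step, which is not a period.\<close>

lemma edge_eq_iff [simp]: "edge x s = edge y r \<longleftrightarrow> s = r \<and> x - y \<in> G"
proof
  assume "edge x s = edge y r"
  then have 1: "(x + lft s) - (y + lft r) \<in> G" and 2: "(x + rgt s) - (y + rgt r) \<in> G"
    unfolding edge_ends by (auto simp: doubleton_eq_iff)
  from diff_G[OF 1 2] have "(lft s - rgt s) - (lft r - rgt r) \<in> G" by (simp add: algebra_simps)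
  moreover have "(lft s - rgt s) - (lft r - rgt r) \<notin> G" if "s \<noteq> r"
    using that by (intro not_in_G) (cases s; cases r; simp add: zero_prod_def)+
  ultimately have "s = r" by blast
  with 1 show "s = r \<and> x - y \<in> G" by simp
next
  assume "s = r \<and> x - y \<in> G"
  then have "s = r" "up (x + lft s) = up (y + lft s)" "dn (x + rgt s) = dn (y + rgt s)" by simp_all
  then show "edge x s = edge y r" by (simp only: edge_ends)
qed

lemma up_in_edge: "up u \<in> edge x s \<longleftrightarrow> x - (u - lft s) \<in> G"
proof -
  have "up u \<in> edge x s \<longleftrightarrow> u - (x + lft s) \<in> G"
    unfolding edge_ends by (simp del: diff_add_eq_diff_diff_swap)
  also have "\<dots> \<longleftrightarrow> x - (u - lft s) \<in> G"
    by (subst diff_G_commute) (simp add: algebra_simps)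
  finally show ?thesis .
qed

lemma dn_in_edge: "dn v \<in> edge x s \<longleftrightarrow> x - (v - rgt s) \<in> G"
proof -
  have "dn v \<in> edge x s \<longleftrightarrow> v - (x + rgt s) \<in> G"
    unfolding edge_ends by (simp del: diff_add_eq_diff_diff_swap)
  also have "\<dots> \<longleftrightarrow> x - (v - rgt s) \<in> G"
    by (subst diff_G_commute) (simp add: algebra_simps)
  finally show ?thesis .
qed

lemma vertex_of_edge: "v \<in> edge x s \<Longrightarrow> (\<exists>u. v = up u) \<or> (\<exists>u. v = dn u)"
  unfolding edge_ends by blast

lemma crossed_edge_dir: "d - c \<in> unit_steps \<longleftrightarrow> (\<exists>s. d = c + step s \<or> c = d + step s)"
proof -
  have 1: "d - c = v \<longleftrightarrow> d = c + v" for c d v :: point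
    by (simp only: diff_eq_eq add.commute[of v])
  have "d - c = - v \<longleftrightarrow> c - d = v" for v
    by (subst neg_equal_iff_equal[symmetric]) (simp only: minus_diff_eq minus_minus)
  then show ?thesis unfolding unit_steps_dir by (simp only: 1)
qed

lemma crossed_edge_arc: "crossed_edge p q t x (x + step s) = edge x s"
  "crossed_edge p q t (x + step s) x = edge x s"
  using crossed_edge_commute[of p q t "x + step s" x] by (simp_all add: edge_def)

lemma polyhex_edges_eq: "polyhex_edges p q t = {edge x s | x s. True}"
proof (intro set_eqI iffI)
  fix e assume "e \<in> polyhex_edges p q t"
  then show "e \<in> {edge x s | x s. True}"
    unfolding polyhex_edges_def crossed_edge_dir using crossed_edge_arc by blast
next
  fix e assume "e \<in> {edge x s | x s. True}"
  then show "e \<in> polyhex_edges p q t"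
    unfolding polyhex_edges_def crossed_edge_dir edge_def by blast
qed

lemma edge_set_eqI:
  assumes "M \<subseteq> polyhex_edges p q t" "N \<subseteq> polyhex_edges p q t"
    and "\<And>x s. edge x s \<in> M \<longleftrightarrow> edge x s \<in> N"
  shows "M = N"
  using assms unfolding polyhex_edges_eq by blast

lemma polyhex_verts_eq: "polyhex_verts p q t = range up \<union> range dn"
proof (intro set_eqI iffI)
  fix v assume "v \<in> polyhex_verts p q t"
  then show "v \<in> range up \<union> range dn"
    unfolding polyhex_verts_def crossed_edge_dir
    by (auto simp: left_end_arc right_end_arc left_right_swap)
next
  fix v assume "v \<in> range up \<union> range dn"
  then consider u where "v = up u" | u where "v = dn u" by blast
  then show "v \<in> polyhex_verts p q t"
  proof cases
    case 1
    then have "v = torus_vertex p q t (left_end u (u + step East))"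
      unfolding left_end_arc by simp
    then show ?thesis unfolding polyhex_verts_def crossed_edge_dir by blast
  next
    case 2
    then have "v = torus_vertex p q t (left_end ((u - rgt East) + step East) (u - rgt East))"
      unfolding left_right_swap right_end_arc by simp
    then show ?thesis unfolding polyhex_verts_def crossed_edge_dir by blast
  qed
qed

lemma hexagon_edges_eq: "hexagon_edges p q t c = {edge c s | s. True} \<union> {edge (c - step s) s | s. True}"
proof -
  have in_edge: "crossed_edge p q t c (c - step s) = edge (c - step s) s" for s
    using crossed_edge_arc(2)[of "c - step s" s] by simp
  have out_edge: "crossed_edge p q t c (c + step s) = edge c s" for s
    by (rule crossed_edge_arc(1))
  have "d - c \<in> unit_steps \<longleftrightarrow> (\<exists>s. d = c + step s \<or> d = c - step s)" for d
    unfolding crossed_edge_dir by (simp add: eq_diff_eq eq_commute[of c])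
  then have "hexagon_edges p q t c =
      {crossed_edge p q t c d | d. \<exists>s. d = c + step s \<or> d = c - step s}"
    unfolding hexagon_edges_def by simp
  also have "\<dots> = {crossed_edge p q t c (c + step s) | s. True} \<union> {crossed_edge p q t c (c - step s) | s. True}"
    by blast
  finally show ?thesis unfolding in_edge out_edge .
qed

lemma edge_in_hexagon_iff:
  "edge x s \<in> hexagon_edges p q t c \<longleftrightarrow> x - c \<in> G \<or> x + step s - c \<in> G"
  by (auto simp: hexagon_edges_eq algebra_simps)

section \<open>Perfect matchings as indicator functions on arcs\<close>

definition ind :: "point set set set \<Rightarrow> point \<Rightarrow> dir \<Rightarrow> int" where
  "ind M x s = of_bool (edge x s \<in> M)"

lemma ind_eq_0_iff [simp]: "ind M x s = 0 \<longleftrightarrow> edge x s \<notin> M"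
  and ind_eq_1_iff [simp]: "ind M x s = 1 \<longleftrightarrow> edge x s \<in> M"
  and ind_nonneg: "ind M x s \<ge> 0"
  by (auto simp: ind_def)

lemma ind_periodic: "x - y \<in> G \<Longrightarrow> ind M x s = ind M y s"
proof -
  assume "x - y \<in> G"
  then have "edge x s = edge y s" by simp
  then show ?thesis by (simp only: ind_def)
qed

lemma ind_eqI:
  assumes "M \<subseteq> polyhex_edges p q t" "N \<subseteq> polyhex_edges p q t" "\<And>x s. ind M x s = ind N x s"
  shows "M = N"
  using assms(3) by (intro edge_set_eqI assms(1,2)) (metis ind_eq_1_iff)

text \<open>Both kinds of vertices meet exactly one edge of each direction; \<open>f s\<close> is
  the tail of the arc crossing the one of direction \<open>s\<close>.\<close>

lemma unique_edge_iff_sum: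
  assumes M: "M \<subseteq> polyhex_edges p q t"
    and v: "\<And>x s. v \<in> edge x s \<longleftrightarrow> x - f s \<in> G"
  shows "(\<exists>!e. e \<in> M \<and> v \<in> e) \<longleftrightarrow> (\<Sum>s\<in>UNIV. ind M (f s) s) = 1"
proof -
  have *: "e \<in> M \<and> v \<in> e \<longleftrightarrow> (\<exists>s. e = edge (f s) s \<and> edge (f s) s \<in> M)" for e
  proof
    assume e: "e \<in> M \<and> v \<in> e"
    with M obtain x s where x: "e = edge x s" unfolding polyhex_edges_eq by blast
    with e v have "e = edge (f s) s" by simp
    with e show "\<exists>s. e = edge (f s) s \<and> edge (f s) s \<in> M" by metis
  next
    assume "\<exists>s. e = edge (f s) s \<and> edge (f s) s \<in> M"
    then show "e \<in> M \<and> v \<in> e" by (auto simp: v)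
  qed
  have distinct: "edge (f East) East \<noteq> edge (f Northwest) Northwest"
    "edge (f East) East \<noteq> edge (f Southwest) Southwest"
    "edge (f Northwest) Northwest \<noteq> edge (f Southwest) Southwest" by simp_all
  have "(\<exists>!e. e = a \<and> a \<in> M \<or> e = b \<and> b \<in> M \<or> e = c \<and> c \<in> M) \<longleftrightarrow>
      of_bool (a \<in> M) + of_bool (b \<in> M) + of_bool (c \<in> M) = (1 :: int)"
    if "a \<noteq> b" "a \<noteq> c" "b \<noteq> c" for a b c
    using that by (cases "a \<in> M"; cases "b \<in> M"; cases "c \<in> M"; simp; blast)
  from this[OF distinct] show ?thesis
    unfolding * sum_dir ex_dir ind_def .
qed

text \<open>In this form the condition is linear, so that it can be added and subtracted.\<close>

lemma polyhex_matching_iff: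
  "polyhex_matching p q t M \<longleftrightarrow> M \<subseteq> polyhex_edges p q t \<and>
     (\<forall>u. (\<Sum>s\<in>UNIV. ind M (u - lft s) s) = 1) \<and>
     (\<forall>v. (\<Sum>s\<in>UNIV. ind M (v - rgt s) s) = 1)"
proof (cases "M \<subseteq> polyhex_edges p q t")
  case True
  have "polyhex_matching p q t M \<longleftrightarrow>
      (\<forall>u. \<exists>!e. e \<in> M \<and> up u \<in> e) \<and> (\<forall>v. \<exists>!e. e \<in> M \<and> dn v \<in> e)"
    unfolding polyhex_matching_def perfect_matching_def polyhex_verts_eq ball_Un
    by (simp only: True simp_thms ball_simps UNIV_I)
  also have "\<dots> \<longleftrightarrow> (\<forall>u. (\<Sum>s\<in>UNIV. ind M (u - lft s) s) = 1) \<and>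
     (\<forall>v. (\<Sum>s\<in>UNIV. ind M (v - rgt s) s) = 1)"
    by (simp only: unique_edge_iff_sum[OF True up_in_edge] unique_edge_iff_sum[OF True dn_in_edge])
  finally show ?thesis using True by simp
qed (auto simp: polyhex_matching_def perfect_matching_def)

lemma matching_up: "polyhex_matching p q t M \<Longrightarrow> (\<Sum>s\<in>UNIV. ind M (u - lft s) s) = 1"
  and matching_dn: "polyhex_matching p q t M \<Longrightarrow> (\<Sum>s\<in>UNIV. ind M (v - rgt s) s) = 1"
  and matching_subset: "polyhex_matching p q t M \<Longrightarrow> M \<subseteq> polyhex_edges p q t"
  unfolding polyhex_matching_iff by blast+

lemma unique_matching_edge:
  assumes "polyhex_matching p q t M" "e \<in> M" "e' \<in> M" "v \<in> e" "v \<in> e'"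
  shows "e = e'"
proof -
  obtain x s where e: "e = edge x s"
    using assms(2) matching_subset[OF assms(1)] unfolding polyhex_edges_eq by blast
  have "v \<in> polyhex_verts p q t"
    using vertex_of_edge[of v x s] assms(4) e unfolding polyhex_verts_eq by blast
  then have "\<exists>!e. e \<in> M \<and> v \<in> e"
    using assms(1) unfolding polyhex_matching_def perfect_matching_def by blast
  then show ?thesis using assms by blast
qed

lemma matching_subset_imp_eq:
  assumes M: "polyhex_matching p q t M" and N: "polyhex_matching p q t N" and sub: "M \<subseteq> N"
  shows "M = N"
proof -
  have "e \<in> M" if e: "e \<in> N" for e
  proof -
    obtain x s where x: "e = edge x s" using e matching_subset[OF N] unfolding polyhex_edges_eq by blast
    then have v: "up (x + lft s) \<in> e" by (simp add: edge_ends)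
    moreover have "up (x + lft s) \<in> polyhex_verts p q t" unfolding polyhex_verts_eq by blast
    ultimately obtain e' where "e' \<in> M" "up (x + lft s) \<in> e'"
      using M unfolding polyhex_matching_def perfect_matching_def by blast
    with unique_matching_edge[OF N e _ v] sub show "e \<in> M" by blast
  qed
  with sub show ?thesis by blast
qed

lemma curl_free_diff:
  assumes "polyhex_matching p q t M" "polyhex_matching p q t N"
  shows "curl_free (\<lambda>x s. ind M x s - ind N x s)"
  unfolding curl_free_def
  by (simp add: sum_subtractf matching_up matching_dn assms)

text \<open>A matching contains a third of all edges; subtracting this average makes its indicator a
  closed form.\<close>

lemma curl_free_density:
  assumes "polyhex_matching p q t M"
  shows "curl_free (\<lambda>x s. 3 * ind M x s - 1)"
proof -
  have "(\<Sum>s\<in>UNIV. 3 * f s - 1) = 3 * (\<Sum>s\<in>UNIV. f s) - 3" for f :: "dir \<Rightarrow> int"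
    by (simp add: sum_dir)
  then show ?thesis unfolding curl_free_def
    by (simp only: matching_up matching_dn assms) simp
qed

section \<open>Flow as the increment of a potential\<close>

definition periodic :: "(point \<Rightarrow> int) \<Rightarrow> bool" where
  "periodic h \<longleftrightarrow> (\<forall>x. \<forall>g\<in>G. h (x + g) = h x)"

lemma periodicD: "periodic h \<Longrightarrow> x - y \<in> G \<Longrightarrow> h x = h y"
  unfolding periodic_def by (metis add.commute diff_add_cancel)

lemma periodic_if_generators:
  assumes "\<And>x. h (x + (p, 0)) = h x" "\<And>x. h (x + (t, q)) = h x"
  shows "periodic h"
proof -
  have mult: "h (x + (k * fst g, k * snd g)) = h x" if g: "\<And>x. h (x + g) = h x" for g x and k :: int
  proof (induction k arbitrary: x rule: int_induct[of _ 0])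
    case base then show ?case by (simp flip: zero_prod_def)
  next
    case (step1 i)
    have "x + ((i + 1) * fst g, (i + 1) * snd g) = x + (i * fst g, i * snd g) + g"
      by (cases x; cases g) (simp add: algebra_simps)
    then show ?case by (simp only: g step1(2))
  next
    case (step2 i)
    have "x + (i * fst g, i * snd g) = x + ((i - 1) * fst g, (i - 1) * snd g) + g"
      by (cases x; cases g) (simp add: algebra_simps)
    then show ?case using g[of "x + ((i - 1) * fst g, (i - 1) * snd g)"] step2(2)[of x]
      by (simp only:)
  qed
  show ?thesis unfolding periodic_def
  proof (intro allI ballI)
    fix x g assume "g \<in> G"
    then obtain m n where "g = (m * p + n * t, n * q)" unfolding translation_group_def by blast
    then have "x + g = x + (m * p, m * 0) + (n * t, n * q)" by (cases x) simp
    moreover have "h (y + (m * p, m * 0)) = h y" "h (y + (n * t, n * q)) = h y" for y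
      using mult[of "(p, 0)" y m] mult[of "(t, q)" y n] assms by simp_all
    ultimately show "h (x + g) = h x" by (simp only:)
  qed
qed

text \<open>Up-vertices a step apart have a common down-neighbour, so all of them have the same
  colour.\<close>

lemma colour_classes:
  assumes "proper_colouring (polyhex_edges p q t) white"
  obtains b where "\<And>u. white (up u) \<longleftrightarrow> b" "\<And>v. white (dn v) \<longleftrightarrow> \<not> b"
proof -
  have neq: "white (up (x + lft s)) \<noteq> white (dn (x + rgt s))" for x s
    using assms unfolding proper_colouring_def polyhex_edges_eq edge_ends by blast
  have same: "white (up (u + step s)) \<longleftrightarrow> white (up u)" for u s
  proof -
    have "u - lft (turn s) + rgt (turn s) = u + step s - lft (turn (turn s)) + rgt (turn (turn s))"
      by (cases s; cases u) auto
    with neq[of "u - lft (turn s)" "turn s"]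
      neq[of "u + step s - lft (turn (turn s))" "turn (turn s)"]
    show ?thesis by (metis diff_add_cancel)
  qed
  have 1: "white (up u) \<longleftrightarrow> white (up 0)" for u
  proof (induction u rule: point_induct)
    case (forward x s) then show ?case using same[of x s] by simp
  next
    case (backward x s) then show ?case using same[of "x - step s" s] by simp
  qed simp
  have "white (dn v) \<longleftrightarrow> \<not> white (up 0)" for v
    using neq[of "v - rgt East" East] 1 by (metis diff_add_cancel)
  with 1 show ?thesis by (rule that)
qed

text \<open>The edges crossed by a dual cycle are distinct, so that the cardinalities become sums
  along the cycle.\<close>

lemma flow_eq_sum:
  assumes L: "dual_cycle p q t L"
  shows "flow p q t white L M =
    (\<Sum>i<length L - 1. of_bool (crossed_edge p q t (L ! i) (L ! Suc i) \<in> M) *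
       (of_bool (white (torus_vertex p q t (left_end (L ! i) (L ! Suc i))))
        - of_bool (white (torus_vertex p q t (right_end (L ! i) (L ! Suc i))))))"
proof -
  define n where "n = length L - 1"
  define e where "e i = crossed_edge p q t (L ! i) (L ! Suc i)" for i
  have "distinct (map e [0..<n])" using L unfolding dual_cycle_def n_def e_def by blast
  then have inj: "inj_on e {..<n}" by (simp add: distinct_map lessThan_atLeast0)
  have card: "int (card ({e i | i. Suc i < length L \<and> P i} \<inter> M)) =
      (\<Sum>i<n. of_bool (e i \<in> M) * of_bool (P i))" for P
  proof -
    have "{e i | i. Suc i < length L \<and> P i} \<inter> M = e ` {i\<in>{..<n}. e i \<in> M \<and> P i}"
      unfolding n_def by auto
    also have "card \<dots> = card {i\<in>{..<n}. e i \<in> M \<and> P i}"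
      using inj by (intro card_image) (auto simp: inj_on_def)
    also have "int \<dots> = (\<Sum>i\<in>{i\<in>{..<n}. e i \<in> M \<and> P i}. 1)" by simp
    also have "\<dots> = (\<Sum>i<n. if e i \<in> M \<and> P i then 1 else 0)"
      by (rule sum.inter_filter) simp
    also have "\<dots> = (\<Sum>i<n. of_bool (e i \<in> M) * of_bool (P i))"
      by (intro sum.cong) (auto simp del: sum.delta)
    finally show ?thesis .
  qed
  show ?thesis
    unfolding flow_def cut_plus_def cut_minus_def
    using card by (simp add: e_def n_def right_diff_distrib sum_subtractf)
qed

text \<open>Each step of the cycle follows an arc forwards or backwards, and a backward step
  exchanges the left and right ends of the crossed edge. So every step contributes the same sign
  times the increment of the potential, and the sum telescopes.\<close>

lemma flow_diff:
  assumes white: "proper_colouring (polyhex_edges p q t) white"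
    and L: "dual_cycle p q t L"
    and h: "potential (\<lambda>x s. ind M x s - ind N x s) h"
  shows "flow p q t white L M - flow p q t white L N = 0 \<longleftrightarrow> h (last L) = h (hd L)"
proof -
  obtain b where b: "\<And>u. white (up u) \<longleftrightarrow> b" "\<And>v. white (dn v) \<longleftrightarrow> \<not> b"
    using colour_classes[OF white] by blast
  \<comment> \<open>Which of the two vertex classes is white decides the sign.\<close>
  define e :: int where "e = (if b then 1 else - 1)"
  let ?w = "\<lambda>c d. of_bool (white (torus_vertex p q t (left_end c d)))
        - of_bool (white (torus_vertex p q t (right_end c d))) :: int"
  let ?m = "\<lambda>M c d. of_bool (crossed_edge p q t c d \<in> M) :: int"
  have h': "h (x + step s) - h x = ind M x s - ind N x s" for x s
    using h unfolding potential_def by simp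
  have cross: "(?m M c d - ?m N c d) * ?w c d = e * (h d - h c)" if cd: "d - c \<in> unit_steps" for c d
  proof -
    from cd consider s where "d = c + step s" | s where "c = d + step s"
      unfolding crossed_edge_dir by blast
    then show ?thesis
    proof cases
      case 1
      then show ?thesis using h'[of c s]
        by (simp add: left_end_arc right_end_arc crossed_edge_arc b e_def ind_def)
    next
      case 2
      then show ?thesis using h'[of d s]
        by (simp add: left_end_arc right_end_arc left_right_swap crossed_edge_arc b e_def ind_def)
    qed
  qed
  have len: "length L \<ge> 2" and steps: "\<And>i. Suc i < length L \<Longrightarrow> L ! Suc i - L ! i \<in> unit_steps"
    using L unfolding dual_cycle_def by auto
  have "flow p q t white L M - flow p q t white L N =
      (\<Sum>i<length L - 1. (?m M (L ! i) (L ! Suc i) - ?m N (L ! i) (L ! Suc i)) * ?w (L ! i) (L ! Suc i))"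
    unfolding flow_eq_sum[OF L] by (simp only: sum_subtractf[symmetric] left_diff_distrib)
  also have "\<dots> = (\<Sum>i<length L - 1. e * (h (L ! Suc i) - h (L ! i)))"
    by (intro sum.cong refl cross steps) auto
  also have "\<dots> = e * (h (L ! (length L - 1)) - h (L ! 0))"
    by (simp only: sum_distrib_left[symmetric] sum_lessThan_telescope[of "\<lambda>i. h (L ! i)"])
  also have "\<dots> = e * (h (last L) - h (hd L))"
  proof -
    have "L \<noteq> []" using len by auto
    then show ?thesis by (simp add: last_conv_nth hd_conv_nth)
  qed
  finally show ?thesis by (simp add: e_def)
qed

section \<open>Flips\<close>

definition hex_ind :: "point \<Rightarrow> point \<Rightarrow> int" where
  "hex_ind c x = of_bool (x - c \<in> G)"

lemma periodic_hex_ind: "periodic (hex_ind c)"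
proof -
  have "x + g - c \<in> G \<longleftrightarrow> x - c \<in> G" if "g \<in> G" for x g
    using add_G[of "x - c" g] diff_G[of "x + g - c" g] that by (auto simp: algebra_simps)
  then show ?thesis unfolding periodic_def hex_ind_def by simp
qed

text \<open>An arc leaves the hexagon at \<open>c\<close>, enters it, or does not cross its
  boundary; it cannot do two of these since no step is a period. The value of \<open>hex_ind\<close>
  at the head is the one at the tail, decreased or increased by one, respectively unchanged.\<close>

lemma hex_cases:
  obtains (out) "x - c \<in> G" "edge x s = edge c s" "hex_ind c x = 1" "hex_ind c (x + step s) = 0"
  | (inn) "x + step s - c \<in> G" "edge x s = edge (c - step s) s" "hex_ind c x = 0" "hex_ind c (x + step s) = 1"
  | (outside) "edge x s \<notin> hexagon_edges p q t c" "hex_ind c x = 0" "hex_ind c (x + step s) = 0"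
proof -
  have "\<not> (x - c \<in> G \<and> x + step s - c \<in> G)"
  proof
    assume "x - c \<in> G \<and> x + step s - c \<in> G"
    then have "(x + step s - c) - (x - c) \<in> G" by (blast intro: diff_G)
    then show False by simp
  qed
  moreover have "edge x s = edge (c - step s) s \<longleftrightarrow> x + step s - c \<in> G"
    unfolding edge_eq_iff by (simp add: diff_diff_eq2 add.commute)
  moreover have "edge x s = edge c s \<longleftrightarrow> x - c \<in> G" by simp
  ultimately consider "x - c \<in> G" "x + step s - c \<notin> G" "edge x s = edge c s"
    | "x + step s - c \<in> G" "x - c \<notin> G" "edge x s = edge (c - step s) s"
    | "x + step s - c \<notin> G" "x - c \<notin> G" by blast
  then show ?thesis
  proof cases
    case 1 then show ?thesis by (intro out) (simp_all add: hex_ind_def)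
  next
    case 2 then show ?thesis by (intro inn) (simp_all add: hex_ind_def)
  next
    case 3 then show ?thesis by (intro outside) (simp_all add: hex_ind_def edge_in_hexagon_iff)
  qed
qed

text \<open>Around a hexagon, edges crossed by outgoing and by incoming arcs alternate: outgoing
  \<open>s\<close>, incoming \<open>turn s\<close>, outgoing \<open>turn (turn s)\<close>, and so
  on. Consecutive ones meet in an up-vertex and in a down-vertex by turns.\<close>

lemma hexagon_turn_up: "up (c + lft (turn s)) \<in> edge c (turn s)" "up (c + lft (turn s)) \<in> edge (c - step s) s"
  by (simp_all add: up_in_edge lft_turn)

lemma hexagon_turn_dn: "dn (c + rgt s) \<in> edge c s" "dn (c + rgt s) \<in> edge (c - step (turn s)) (turn s)"
  by (simp_all add: dn_in_edge rgt_turn)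

text \<open>At each vertex of the hexagon the third edge lies outside the hexagon, so the two
  matchings agree on it, and the differences on the two hexagon edges cancel. Going round the
  hexagon, the difference is therefore a constant \<open>e\<close> on the edges of outgoing arcs and
  \<open>- e\<close> on those of incoming arcs.\<close>

lemma resonance_adj_height:
  assumes "(M, N) \<in> resonance_adj p q t"
  obtains c e where "sym_diff M N = hexagon_edges p q t c" "e = 1 \<or> e = (- 1 :: int)"
    "\<And>x s. ind M x s - ind N x s = e * (hex_ind c x - hex_ind c (x + step s))"
proof -
  from assms obtain c where M: "polyhex_matching p q t M" and N: "polyhex_matching p q t N"
    and c: "sym_diff M N = hexagon_edges p q t c" unfolding resonance_adj_def by blast
  define d where "d x s = ind M x s - ind N x s" for x s
  have d0: "d x s = 0" if "edge x s \<notin> hexagon_edges p q t c" for x s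
    using that unfolding c[symmetric] d_def ind_def by auto
  have d1: "d x s = 1 \<or> d x s = -1" if "edge x s \<in> hexagon_edges p q t c" for x s
    using that unfolding c[symmetric] d_def ind_def by auto
  have dper: "d x s = d y s" if "x - y \<in> G" for x y s
    using ind_periodic[OF that] unfolding d_def by simp
  have at_up: "d c (turn s) = - d (c - step s) s" for s
  proof -
    let ?u = "c + lft (turn s)"
    have third: "edge (?u - lft (turn (turn s))) (turn (turn s)) \<notin> hexagon_edges p q t c"
    proof -
      have "?u - lft (turn (turn s)) - c = step (turn s)"
        by (simp add: lft_turn)
      moreover have "?u - lft (turn (turn s)) + step (turn (turn s)) - c = - step s"
        by (simp add: lft_turn step_turn_turn)
      ultimately show ?thesis by (simp only: edge_in_hexagon_iff step_not_in_G simp_thms)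
    qed
    have "(\<Sum>r\<in>UNIV. d (?u - lft r) r) = 0"
      unfolding d_def by (simp add: sum_subtractf matching_up M N)
    then have "d (?u - lft s) s + d (?u - lft (turn s)) (turn s) = 0"
      using d0[OF third] by (simp only: sum_dir_turn[of _ s])
    then show ?thesis by (simp add: lft_turn)
  qed
  have at_dn: "d (c - step (turn s)) (turn s) = - d c s" for s
  proof -
    let ?u = "c + rgt s"
    have third: "edge (?u - rgt (turn (turn s))) (turn (turn s)) \<notin> hexagon_edges p q t c"
    proof -
      have "?u - rgt (turn (turn s)) - c = step s"
        by (simp add: rgt_turn step_turn_turn)
      moreover have "?u - rgt (turn (turn s)) + step (turn (turn s)) - c = - step (turn s)"
        by (simp add: rgt_turn)
      ultimately show ?thesis by (simp only: edge_in_hexagon_iff step_not_in_G simp_thms)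
    qed
    have "(\<Sum>r\<in>UNIV. d (?u - rgt r) r) = 0"
      unfolding d_def by (simp add: sum_subtractf matching_dn M N)
    then have "d (?u - rgt s) s + d (?u - rgt (turn s)) (turn s) = 0"
      using d0[OF third] by (simp only: sum_dir_turn[of _ s])
    then show ?thesis by (simp add: rgt_turn)
  qed
  define e where "e = d c East"
  \<comment> \<open>The equations at the six vertices link all edges of the hexagon.\<close>
  have out: "d c s = e" for s
    using at_up[of East] at_up[of Northwest] at_up[of Southwest]
      at_dn[of East] at_dn[of Northwest] at_dn[of Southwest]
    by (cases s) (simp_all add: e_def)
  have inn: "d (c - step s) s = - e" for s
    using at_up[of s] out[of "turn s"] by simp
  have "d x s = e * (hex_ind c x - hex_ind c (x + step s))" for x s
  proof (cases rule: hex_cases[where x = x and c = c and s = s])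
    case out': out
    then show ?thesis using dper[of x c s] out[of s] by simp
  next
    case inn': inn
    then have "x - (c - step s) \<in> G" by (simp only: edge_eq_iff)
    then show ?thesis using dper[of x "c - step s" s] inn[of s] inn' by simp
  next
    case outside
    then show ?thesis using d0 by simp
  qed
  moreover have "edge c East \<in> hexagon_edges p q t c" unfolding hexagon_edges_eq by blast
  ultimately show ?thesis using that c d1 unfolding e_def d_def by blast
qed

lemma resonance_adj_sym: "(M, N) \<in> resonance_adj p q t \<Longrightarrow> (N, M) \<in> resonance_adj p q t"
  unfolding resonance_adj_def by (auto simp: Un_commute)

lemma flow_resonance_adj:
  assumes "proper_colouring (polyhex_edges p q t) white" "dual_cycle p q t L"
    and "(M, N) \<in> resonance_adj p q t"
  shows "flow p q t white L M = flow p q t white L N"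
proof -
  obtain c e where "\<And>x s. ind M x s - ind N x s = e * (hex_ind c x - hex_ind c (x + step s))"
    using resonance_adj_height[OF assms(3)] by metis
  then have "potential (\<lambda>x s. ind M x s - ind N x s) (\<lambda>x. - e * hex_ind c x)"
    unfolding potential_def by (simp add: algebra_simps)
  moreover have "hex_ind c (last L) = hex_ind c (hd L)"
    using assms(2) by (intro periodicD[OF periodic_hex_ind]) (simp add: dual_cycle_def)
  ultimately show ?thesis using flow_diff[OF assms(1,2)] by fastforce
qed

text \<open>Flipping amounts to adding a gradient to the indicator of \<open>M\<close>, and
  gradients sum to zero at each vertex. So the result is a perfect matching as soon as its values
  are 0 and 1.\<close>

lemma flip:
  assumes M: "polyhex_matching p q t M" and inn: "\<And>s. edge (c - step s) s \<in> M"
  obtains N where "(M, N) \<in> resonance_adj p q t"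
    "\<And>x s. ind N x s = ind M x s + hex_ind c x - hex_ind c (x + step s)"
proof -
  define d where "d x s = ind M x s + hex_ind c x - hex_ind c (x + step s)" for x s
  \<comment> \<open>An outgoing edge shares its up-vertex with an incoming one, which is matched.\<close>
  have out: "edge c s \<notin> M" for s
  proof -
    define r where "r = turn (turn s)"
    have s: "s = turn r" by (simp add: r_def)
    let ?u = "c + lft (turn r)"
    have "ind M (?u - lft r) r + ind M (?u - lft (turn r)) (turn r)
        + ind M (?u - lft (turn (turn r))) (turn (turn r)) = 1"
      using matching_up[OF M, of ?u] by (simp only: sum_dir_turn[of _ r])
    moreover have "ind M (?u - lft r) r = 1" using inn[of r] by (simp add: lft_turn)
    moreover have "ind M (?u - lft (turn (turn r))) (turn (turn r)) \<ge> 0" by (rule ind_nonneg)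
    ultimately have "ind M (?u - lft (turn r)) (turn r) \<le> 0" by linarith
    then have "ind M c s = 0" using ind_nonneg[of M c s] by (simp add: s)
    then show ?thesis by simp
  qed
  have ind_d: "of_bool (d x s = 1) = d x s" for x s
  proof (cases rule: hex_cases[where x = x and c = c and s = s])
    case out': out
    then show ?thesis using ind_periodic[of x c M s] out[of s] by (simp add: d_def ind_def)
  next
    case inn': inn
    then have "ind M x s = 1" using inn[of s] by (simp only: ind_eq_1_iff)
    with inn' show ?thesis by (simp add: d_def)
  next
    case outside
    then show ?thesis by (simp add: d_def ind_def)
  qed
  have dper: "d x s = d y s" if "x - y \<in> G" for x y s
    using ind_periodic[OF that] periodicD[OF periodic_hex_ind that]
      periodicD[OF periodic_hex_ind, of "x + step s" "y + step s"] that
    unfolding d_def by simp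
  define N where "N = {edge x s | x s. d x s = 1}"
  have in_N: "edge x s \<in> N \<longleftrightarrow> d x s = 1" for x s
  proof
    assume "edge x s \<in> N"
    then obtain y r where "edge x s = edge y r" "d y r = 1" unfolding N_def by blast
    then show "d x s = 1" using dper by (metis edge_eq_iff)
  qed (unfold N_def, blast)
  have ind_N: "ind N x s = d x s" for x s
    unfolding ind_def[of N] in_N by (rule ind_d)
  have hex_curl: "curl_free (\<lambda>x s. hex_ind c (x + step s) - hex_ind c x)"
    by (rule potential_imp_curl_free[of _ "hex_ind c"]) (simp add: potential_def)
  have dsum: "(\<Sum>s\<in>UNIV. d (f s) s) =
    (\<Sum>s\<in>UNIV. ind M (f s) s) - (\<Sum>s\<in>UNIV. hex_ind c (f s + step s) - hex_ind c (f s))" for f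
    unfolding d_def sum_dir by simp
  have "polyhex_matching p q t N"
    unfolding polyhex_matching_iff ind_N
  proof (intro conjI allI)
    show "N \<subseteq> polyhex_edges p q t" unfolding N_def polyhex_edges_eq by blast
    show "(\<Sum>s\<in>UNIV. d (u - lft s) s) = 1" for u
      using hex_curl unfolding dsum[of "\<lambda>s. u - lft s"] matching_up[OF M] curl_free_def by simp
    show "(\<Sum>s\<in>UNIV. d (v - rgt s) s) = 1" for v
      using hex_curl unfolding dsum[of "\<lambda>s. v - rgt s"] matching_dn[OF M] curl_free_def by simp
  qed
  moreover have "sym_diff M N = hexagon_edges p q t c"
  proof -
    have "edge x s \<in> sym_diff M N \<longleftrightarrow> edge x s \<in> hexagon_edges p q t c" for x s
    proof -
      have "edge x s \<in> sym_diff M N \<longleftrightarrow> ind M x s \<noteq> ind N x s" by (auto simp: ind_def)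
      also have "\<dots> \<longleftrightarrow> edge x s \<in> hexagon_edges p q t c"
        unfolding ind_N d_def by (cases rule: hex_cases[where x = x and c = c and s = s]) (auto simp: edge_in_hexagon_iff)
      finally show ?thesis .
    qed
    moreover have "N \<subseteq> polyhex_edges p q t" unfolding N_def polyhex_edges_eq by blast
    then have "sym_diff M N \<subseteq> polyhex_edges p q t" using matching_subset[OF M] by blast
    moreover have "hexagon_edges p q t c \<subseteq> polyhex_edges p q t"
      unfolding hexagon_edges_eq polyhex_edges_eq by blast
    ultimately show ?thesis by (intro edge_set_eqI)
  qed
  ultimately have "(M, N) \<in> resonance_adj p q t"
    using M unfolding resonance_adj_def by blast
  then show ?thesis using that ind_N unfolding d_def by blast
qed

section \<open>Ladders are preserved by flips\<close>

definition parallel_edges :: "dir \<Rightarrow> point set set set" where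
  "parallel_edges s = {edge x s | x. True}"

lemma edge_in_parallel_edges [simp]: "edge x r \<in> parallel_edges s \<longleftrightarrow> r = s"
proof
  assume "edge x r \<in> parallel_edges s"
  then obtain y where "edge x r = edge y s" unfolding parallel_edges_def by blast
  then show "r = s" by simp
  qed (unfold parallel_edges_def, blast)

lemma edge_directions_eq: "edge_directions p q t = range parallel_edges"
proof -
  have "direction_class p q t (step s) = parallel_edges s" for s
    unfolding direction_class_def parallel_edges_def edge_def ..
  from this[of East] this[of Northwest]
  have 1: "direction_class p q t (1, 0) = parallel_edges East"
    "direction_class p q t (-1, 1) = parallel_edges Northwest" by simp_all
  have "crossed_edge p q t c (c + (0, 1)) = edge (c + (0, 1)) Southwest" for c
    using crossed_edge_arc(2)[of "c + (0, 1)" Southwest] by (cases c) simp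
  then have "direction_class p q t (0, 1) = {edge (c + (0, 1)) Southwest | c. True}"
    unfolding direction_class_def by simp
  also have "\<dots> = parallel_edges Southwest"
    unfolding parallel_edges_def by (metis diff_add_cancel)
  finally show ?thesis unfolding edge_directions_def by (auto simp: 1 UNIV_dir)
qed

lemma unique_parallel_edge:
  assumes "v \<in> edge x s" "v \<in> edge y s"
  shows "edge x s = edge y s"
proof -
  from vertex_of_edge[OF assms(1)] consider u where "v = up u" | u where "v = dn u" by blast
  then obtain z where "x - z \<in> G" "y - z \<in> G"
    using assms by cases (auto simp: up_in_edge dn_in_edge)
  then have "x - z - (y - z) \<in> G" by (rule diff_G)
  then show ?thesis by simp
qed

lemma cyc_edge_in_cyc_edges: "Z \<noteq> [] \<Longrightarrow> cyc_edge Z i \<in> cyc_edges Z"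
proof -
  assume "Z \<noteq> []"
  then have "cyc_edge Z i = cyc_edge Z (i mod length Z)" "i mod length Z < length Z"
    by (simp_all add: cyc_edge_def mod_Suc_eq)
  then show ?thesis unfolding cyc_edges_def by blast
qed

text \<open>Here \<open>r\<close> is the direction that the zigzag does not use. Since a ladder
  alternates, each of its vertices is matched along the ladder; and the ladder passes through the
  edges of both other directions at each of its vertices.\<close>

lemma ladder_saturated:
  assumes M: "polyhex_matching p q t M" and Z: "is_ladder p q t M Z"
  obtains r where "\<And>x. edge x r \<notin> cyc_edges Z"
    "\<And>x v. v \<in> \<Union>(cyc_edges Z) \<Longrightarrow> v \<in> edge x r \<Longrightarrow> edge x r \<notin> M"
    "\<And>x s v. v \<in> \<Union>(cyc_edges Z) \<Longrightarrow> v \<in> edge x s \<Longrightarrow> s \<noteq> r \<Longrightarrow> edge x s \<in> cyc_edges Z"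
proof -
  from Z have len: "length Z \<ge> 3" and E: "cyc_edges Z \<subseteq> polyhex_edges p q t"
    and alt: "\<And>i. i < length Z \<Longrightarrow> cyc_edge Z i \<in> M \<longleftrightarrow> cyc_edge Z (Suc i) \<notin> M"
    unfolding is_ladder_def zigzag_cycle_def graph_cycle_def alternating_cycle_def by blast+
  from len have ne: "Z \<noteq> []" by auto
  from Z obtain a b where "parallel_edges a \<noteq> parallel_edges b" and
    dirs: "\<And>i. i < length Z \<Longrightarrow> cyc_edge Z i \<in> parallel_edges a \<and> cyc_edge Z (Suc i) \<in> parallel_edges b \<or>
          cyc_edge Z i \<in> parallel_edges b \<and> cyc_edge Z (Suc i) \<in> parallel_edges a"
    unfolding is_ladder_def zigzag_cycle_def edge_directions_eq by blast
  then have "a \<noteq> b" by blast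
  then obtain r where r: "r \<noteq> a" "r \<noteq> b" "\<And>s. s = a \<or> s = b \<or> s = r"
    using third_direction[OF \<open>a \<noteq> b\<close>] by blast
  have types: "s = a \<or> s = b" if "edge x s \<in> cyc_edges Z" for x s
  proof -
    from that obtain i where i: "i < length Z" "edge x s = cyc_edge Z i" unfolding cyc_edges_def by blast
    from dirs[OF i(1)] show ?thesis unfolding i(2)[symmetric] by auto
  qed
  have at_vertex: "\<exists>y y'. edge y a \<in> cyc_edges Z \<and> edge y' b \<in> cyc_edges Z \<and> v \<in> edge y a \<and> v \<in> edge y' b
      \<and> (edge y a \<in> M \<longleftrightarrow> edge y' b \<notin> M)" if v: "v \<in> \<Union>(cyc_edges Z)" for v
  proof -
    define n where "n = length Z"
    from v obtain i where "i < n" "v = Z ! (i mod n) \<or> v = Z ! (Suc i mod n)"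
      unfolding cyc_edges_def cyc_edge_def n_def by blast
    \<comment> \<open>Each vertex of the cycle is the second vertex of an edge; for the one at position \<open>i\<close> this is
      the edge number \<open>i - 1\<close> modulo \<open>n\<close>, written with \<open>i + n - 1\<close> because of truncation.\<close>
    moreover have "i mod n = Suc ((i + n - 1) mod n) mod n"
      using \<open>i < n\<close> by (simp add: mod_Suc_eq)
    moreover have "(i + n - 1) mod n < n" using \<open>i < n\<close> by simp
    ultimately obtain j where j: "j < n" "v = Z ! (Suc j mod n)" by metis
    then have v_in: "v \<in> cyc_edge Z j" "v \<in> cyc_edge Z (Suc j)" unfolding cyc_edge_def n_def by auto
    have in_Z: "cyc_edge Z j \<in> cyc_edges Z" "cyc_edge Z (Suc j) \<in> cyc_edges Z"
      using cyc_edge_in_cyc_edges[OF ne] by blast+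
    have alt_j: "cyc_edge Z j \<in> M \<longleftrightarrow> cyc_edge Z (Suc j) \<notin> M"
      using alt j(1) unfolding n_def by blast
    have "cyc_edge Z j \<in> parallel_edges a \<and> cyc_edge Z (Suc j) \<in> parallel_edges b \<or>
          cyc_edge Z j \<in> parallel_edges b \<and> cyc_edge Z (Suc j) \<in> parallel_edges a"
      using dirs j(1) unfolding n_def by blast
    then consider y y' where "cyc_edge Z j = edge y a" "cyc_edge Z (Suc j) = edge y' b"
      | y y' where "cyc_edge Z j = edge y b" "cyc_edge Z (Suc j) = edge y' a"
      unfolding parallel_edges_def by blast
    then show ?thesis
    proof cases
      case (1 y y')
      with v_in in_Z alt_j show ?thesis by (intro exI[of _ y] exI[of _ y']) (simp only: simp_thms)
    next
      case (2 y y')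
      with v_in in_Z alt_j show ?thesis by (intro exI[of _ y'] exI[of _ y]) (simp only: simp_thms)
    qed
  qed
  show ?thesis
  proof
    show "edge x r \<notin> cyc_edges Z" for x using types r by blast
    fix x v assume v: "v \<in> \<Union>(cyc_edges Z)"
    obtain y y' where y: "edge y a \<in> cyc_edges Z" "v \<in> edge y a"
      and y': "edge y' b \<in> cyc_edges Z" "v \<in> edge y' b"
      and M_ab: "edge y a \<in> M \<longleftrightarrow> edge y' b \<notin> M"
      using at_vertex[OF v] by blast
    show "edge x r \<notin> M" if x: "v \<in> edge x r"
    proof
      assume x_in: "edge x r \<in> M"
      show False
      proof (cases "edge y a \<in> M")
        case True
        from unique_matching_edge[OF M x_in True x y(2)] r(1) show False by simp
      next
        case False
        with M_ab have "edge y' b \<in> M" by blast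
        from unique_matching_edge[OF M x_in this x y'(2)] r(2) show False by simp
      qed
    qed
    show "edge x s \<in> cyc_edges Z" if x: "v \<in> edge x s" and "s \<noteq> r" for s
    proof -
      from r(3)[of s] \<open>s \<noteq> r\<close> consider "s = a" | "s = b" by blast
      then show ?thesis
      proof cases
        case 1
        with unique_parallel_edge[of v x s y] x y show ?thesis by metis
      next
        case 2
        with unique_parallel_edge[of v x s y'] x y' show ?thesis by metis
      qed
    qed
  qed
qed

text \<open>Removing the two opposite edges of direction \<open>r\<close> from the hexagon leaves
  two paths, each having two edges of the other directions. A ladder that contains one edge of such
  a path contains the whole path, whose end-vertices lie on the two edges of direction
  \<open>r\<close>. So neither of these is matched, whereas a flippable hexagon contains a matching
  edge of every direction.\<close>

lemma ladder_avoids_flip: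
  assumes M: "polyhex_matching p q t M" and Z: "is_ladder p q t M Z"
    and c: "\<And>s. edge c s \<in> M \<or> edge (c - step s) s \<in> M"
  shows "cyc_edges Z \<inter> hexagon_edges p q t c = {}"
proof (rule ccontr)
  assume "cyc_edges Z \<inter> hexagon_edges p q t c \<noteq> {}"
  then obtain s where s: "edge c s \<in> cyc_edges Z \<or> edge (c - step s) s \<in> cyc_edges Z"
    unfolding hexagon_edges_eq by blast
  obtain r where r1: "\<And>x. edge x r \<notin> cyc_edges Z"
    and r2: "\<And>x v. v \<in> \<Union>(cyc_edges Z) \<Longrightarrow> v \<in> edge x r \<Longrightarrow> edge x r \<notin> M"
    and r3: "\<And>x s v. v \<in> \<Union>(cyc_edges Z) \<Longrightarrow> v \<in> edge x s \<Longrightarrow> s \<noteq> r \<Longrightarrow> edge x s \<in> cyc_edges Z"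
    by (rule ladder_saturated[OF M Z]) (rule that)
  note up1 = hexagon_turn_up(1) and up2 = hexagon_turn_up(2)
    and dn1 = hexagon_turn_dn(1) and dn2 = hexagon_turn_dn(2)
  have "s \<noteq> r" using s r1 by blast
  then consider "s = turn r" | "s = turn (turn r)" using turn_exhaust by blast
  then have "(edge c (turn r) \<in> cyc_edges Z \<and> edge (c - step (turn (turn r))) (turn (turn r)) \<in> cyc_edges Z) \<or>
    (edge (c - step (turn r)) (turn r) \<in> cyc_edges Z \<and> edge c (turn (turn r)) \<in> cyc_edges Z)"
  proof cases
    case 1
    from s show ?thesis unfolding 1
      using r3[OF UnionI[OF _ dn1[of c "turn r"]] dn2[of c "turn r"]]
        r3[OF UnionI[OF _ up2[of c "turn r"]] up1[of c "turn r"]] by auto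
  next
    case 2
    from s show ?thesis unfolding 2
      using r3[OF UnionI[OF _ dn2[of c "turn r"]] dn1[of c "turn r"]]
        r3[OF UnionI[OF _ up1[of c "turn r"]] up2[of c "turn r"]] by auto
  qed
  then have "edge c r \<notin> M \<and> edge (c - step r) r \<notin> M"
  proof
    assume a: "edge c (turn r) \<in> cyc_edges Z \<and> edge (c - step (turn (turn r))) (turn (turn r)) \<in> cyc_edges Z"
    then show ?thesis
      using r2[OF UnionI[OF _ up1[of c r]] up2[of c r]]
        r2[OF UnionI[OF _ up2[of c "turn (turn r)"]], of c] up1[of c "turn (turn r)"] by simp
  next
    assume a: "edge (c - step (turn r)) (turn r) \<in> cyc_edges Z \<and> edge c (turn (turn r)) \<in> cyc_edges Z"
    then show ?thesis
      using r2[OF UnionI[OF _ dn2[of c r]] dn1[of c r]]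
        r2[OF UnionI[OF _ dn1[of c "turn (turn r)"]], of "c - step r"] dn2[of c "turn (turn r)"] by simp
  qed
  with c show False by blast
qed

lemma ladder_resonance_adj:
  assumes adj: "(M, N) \<in> resonance_adj p q t" and Z: "is_ladder p q t M Z"
  shows "is_ladder p q t N Z \<and> M \<inter> cyc_edges Z = N \<inter> cyc_edges Z"
proof -
  have M: "polyhex_matching p q t M" using adj unfolding resonance_adj_def by blast
  obtain c e where c: "sym_diff M N = hexagon_edges p q t c" and e: "e = 1 \<or> e = (- 1 :: int)"
    and ind: "\<And>x s. ind M x s - ind N x s = e * (hex_ind c x - hex_ind c (x + step s))"
    by (rule resonance_adj_height[OF adj]) (rule that)
  have "edge c s \<in> M \<or> edge (c - step s) s \<in> M" for s
  proof (rule ccontr)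
    assume "\<not> ?thesis"
    then have M0: "ind M c s = 0" "ind M (c - step s) s = 0" by simp_all
    have "hex_ind c (c - step s) = 0" "hex_ind c (c + step s) = 0" "hex_ind c c = 1"
      by (simp_all add: hex_ind_def)
    then have "ind M c s - ind N c s = e" "ind M (c - step s) s - ind N (c - step s) s = - e"
      using ind[of c s] ind[of "c - step s" s] by simp_all
    with e M0 ind_nonneg[of N c s] ind_nonneg[of N "c - step s" s] show False by linarith
  qed
  then have "cyc_edges Z \<inter> hexagon_edges p q t c = {}" by (rule ladder_avoids_flip[OF M Z])
  then have eq: "e \<in> M \<longleftrightarrow> e \<in> N" if "e \<in> cyc_edges Z" for e
    using that unfolding c[symmetric] by blast
  have "Z \<noteq> []" using Z unfolding is_ladder_def zigzag_cycle_def graph_cycle_def by auto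
  then have "alternating_cycle N Z"
    using Z eq cyc_edge_in_cyc_edges[of Z] unfolding is_ladder_def alternating_cycle_def by blast
  then show ?thesis using Z eq unfolding is_ladder_def by blast
qed

lemma same_ladders_resonance_adj:
  assumes "(M, N) \<in> resonance_adj p q t"
  shows "same_ladders p q t M N"
  using ladder_resonance_adj[OF assms] ladder_resonance_adj[OF resonance_adj_sym[OF assms]]
  unfolding same_ladders_def by blast

lemma same_ladders_trans: "same_ladders p q t M N \<Longrightarrow> same_ladders p q t N K \<Longrightarrow> same_ladders p q t M K"
  unfolding same_ladders_def by blast

section \<open>Matchings without edges of some direction\<close>

lemma matching_two_of_three_up:
  assumes "polyhex_matching p q t M" "\<And>x. edge x s \<notin> M"
  shows "edge (u - lft (turn s)) (turn s) \<in> M \<longleftrightarrow> edge (u - lft (turn (turn s))) (turn (turn s)) \<notin> M"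
proof -
  have "ind M (u - lft s) s + ind M (u - lft (turn s)) (turn s)
      + ind M (u - lft (turn (turn s))) (turn (turn s)) = 1"
    using matching_up[OF assms(1), of u] by (simp only: sum_dir_turn[of _ s])
  moreover have "ind M (u - lft s) s = 0" using assms(2) by (simp only: ind_eq_0_iff not_False_eq_True)
  ultimately show ?thesis unfolding ind_def by (auto simp del: edge_eq_iff split: if_splits)
qed

lemma matching_two_of_three_dn:
  assumes "polyhex_matching p q t M" "\<And>x. edge x s \<notin> M"
  shows "edge (v - rgt (turn s)) (turn s) \<in> M \<longleftrightarrow> edge (v - rgt (turn (turn s))) (turn (turn s)) \<notin> M"
proof -
  have "ind M (v - rgt s) s + ind M (v - rgt (turn s)) (turn s)
      + ind M (v - rgt (turn (turn s))) (turn (turn s)) = 1"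
    using matching_dn[OF assms(1), of v] by (simp only: sum_dir_turn[of _ s])
  moreover have "ind M (v - rgt s) s = 0" using assms(2) by (simp only: ind_eq_0_iff not_False_eq_True)
  ultimately show ?thesis unfolding ind_def by (auto simp del: edge_eq_iff split: if_splits)
qed

text \<open>Starting from any up-vertex, alternate between the other two directions. Every second
  vertex is a translate of the first by a multiple of \<open>step s\<close>, so the cycle closes up
  after twice the order of \<open>step s\<close> modulo the period lattice. At each vertex the third
  edge is not in \<open>M\<close>, so exactly one of the two edges of the zigzag is.\<close>

lemma missing_direction_ladder:
  assumes M: "polyhex_matching p q t M" and missing: "\<And>x. edge x s \<notin> M"
  obtains Z where "is_ladder p q t M Z"
    "edge (u - lft (turn s)) (turn s) \<in> cyc_edges Z"
    "edge (u + step s - lft (turn (turn s))) (turn (turn s)) \<in> cyc_edges Z"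
proof -
  define n where "n = (LEAST n. n > 0 \<and> times_step n s \<in> G)"
  have n: "n > 0" "times_step n s \<in> G"
    using LeastI_ex[OF step_finite_order[of s]] unfolding n_def by blast+
  have n_min: "times_step i s \<notin> G" if "0 < i" "i < n" for i
    using not_less_Least[of i "\<lambda>n. n > 0 \<and> times_step n s \<in> G"] that unfolding n_def by blast
  \<comment> \<open>A single step is not a period, so the zigzag has at least four edges.\<close>
  have "n \<noteq> 1" using n(2) by auto
  with n(1) have n2: "n \<ge> 2" by simp
  \<comment> \<open>The down-vertex following the up-vertex \<open>w\<close> on the zigzag is the one at \<open>w + \<delta>\<close>.\<close>
  define \<delta> where "\<delta> = rgt (turn s) - lft (turn s)"
  define vtx where "vtx j = (if even j then up (u + times_step (j div 2) s)
    else dn (u + \<delta> + times_step (j div 2) s))" for j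
  define Z where "Z = map vtx [0..<2 * n]"
  define e where "e j = (let w = u + times_step (j div 2) s in
    if even j then edge (w - lft (turn s)) (turn s)
    else edge (w + step s - lft (turn (turn s))) (turn (turn s)))" for j
  have len: "length Z = 2 * n" by (simp add: Z_def)
  have wrap: "times_step (n * k) s \<in> G" for k
    by (induction k) (simp_all add: times_step_add add_G n)
  have vtx_mod: "vtx (j mod (2 * n)) = vtx j" for j
  proof -
    define i k where "i = j mod (2 * n)" and "k = j div (2 * n)"
    have j: "j = i + 2 * (n * k)" unfolding i_def k_def by (metis mod_mult_div_eq mult.assoc)
    have "times_step (j div 2) s = times_step (i div 2) s + times_step (n * k) s"
      unfolding j by (simp add: times_step_add)
    moreover have "even j \<longleftrightarrow> even i" unfolding j by simp
    ultimately have "vtx i = vtx j" using wrap[of k] by (simp add: vtx_def)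
    then show ?thesis unfolding i_def .
  qed
  have Z_nth: "Z ! (j mod length Z) = vtx j" for j
  proof -
    have "j mod (2 * n) < 2 * n" using n(1) by simp
    then have "Z ! (j mod (2 * n)) = vtx (j mod (2 * n))" unfolding Z_def by simp
    then show ?thesis unfolding len vtx_mod .
  qed
  have e_ends: "e j = {vtx j, vtx (Suc j)}" for j
  proof (cases "even j")
    case True
    then have "Suc j div 2 = j div 2" by simp
    with True show ?thesis by (simp add: e_def vtx_def Let_def edge_ends \<delta>_def algebra_simps)
  next
    case False
    then have Suc_div: "Suc j div 2 = Suc (j div 2)" by presburger
    have "- lft (turn (turn s)) + rgt (turn (turn s)) = \<delta> - step s"
      using turn_shift[of s] by (simp add: \<delta>_def algebra_simps)
    then have shift: "u + times_step (j div 2) s + step s - lft (turn (turn s)) + rgt (turn (turn s))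
        = u + \<delta> + times_step (j div 2) s"
      by (metis (no_types, lifting) add.assoc add.commute diff_add_cancel uminus_add_conv_diff)
    have "e j = edge (u + times_step (j div 2) s + step s - lft (turn (turn s))) (turn (turn s))"
      "vtx j = dn (u + \<delta> + times_step (j div 2) s)"
      "vtx (Suc j) = up (u + times_step (j div 2) s + step s)"
      using False by (simp_all only: e_def vtx_def Let_def Suc_div times_step_simps even_Suc if_False if_True not_False_eq_True add.assoc)
    then show ?thesis by (simp only: edge_ends shift diff_add_cancel insert_commute)
  qed
  have cyc: "cyc_edge Z j = e j" for j
    unfolding cyc_edge_def Z_nth e_ends ..
  have e_dir: "e j \<in> parallel_edges (if even j then turn s else turn (turn s))" for j
    by (simp add: e_def Let_def)
  have cyc_edges: "e j \<in> cyc_edges Z" for j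
  proof -
    have "Z \<noteq> []" using len n(1) by auto
    then show ?thesis using cyc_edge_in_cyc_edges[of Z j] unfolding cyc by blast
  qed
  have apart: "times_step a s - times_step b s \<notin> G" if "a \<noteq> b" "a < n" "b < n" for a b
  proof -
    have *: "times_step a s - times_step b s \<notin> G" if "b < a" "a < n" for a b
      using n_min[of "a - b"] times_step_add[of "a - b" b s] that by simp
    show ?thesis using *[of a b] *[of b a] that diff_G_commute by (metis linorder_neqE_nat)
  qed
  have "distinct Z"
    unfolding Z_def distinct_map
  proof (intro conjI inj_onI)
    fix i j assume ij: "i \<in> set [0..<2 * n]" "j \<in> set [0..<2 * n]" and eq: "vtx i = vtx j"
    have par: "even i \<longleftrightarrow> even j" using eq by (auto simp: vtx_def split: if_splits)
    have "times_step (i div 2) s - times_step (j div 2) s \<in> G"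
      using eq par by (auto simp: vtx_def split: if_splits)
    moreover have "i div 2 < n" "j div 2 < n" using ij by auto
    ultimately have "i div 2 = j div 2" using apart by blast
    with par show "i = j" by presburger
  qed simp
  moreover have "cyc_edges Z \<subseteq> polyhex_edges p q t"
    unfolding cyc_edges_def cyc polyhex_edges_eq e_def Let_def by auto
  ultimately have "graph_cycle (polyhex_edges p q t) Z"
    unfolding graph_cycle_def using len n2 by simp
  moreover have "\<exists>A\<in>edge_directions p q t. \<exists>B\<in>edge_directions p q t. A \<noteq> B \<and>
        (\<forall>i<length Z. cyc_edge Z i \<in> A \<and> cyc_edge Z (Suc i) \<in> B \<or>
                      cyc_edge Z i \<in> B \<and> cyc_edge Z (Suc i) \<in> A)"
  proof (intro bexI conjI)
    have "edge 0 (turn s) \<notin> parallel_edges (turn (turn s))" "edge 0 (turn s) \<in> parallel_edges (turn s)"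
      by simp_all
    then show "parallel_edges (turn s) \<noteq> parallel_edges (turn (turn s))" by blast
    show "\<forall>i<length Z. cyc_edge Z i \<in> parallel_edges (turn s) \<and> cyc_edge Z (Suc i) \<in> parallel_edges (turn (turn s)) \<or>
        cyc_edge Z i \<in> parallel_edges (turn (turn s)) \<and> cyc_edge Z (Suc i) \<in> parallel_edges (turn s)"
    proof (intro allI impI)
      fix i
      show "cyc_edge Z i \<in> parallel_edges (turn s) \<and> cyc_edge Z (Suc i) \<in> parallel_edges (turn (turn s)) \<or>
        cyc_edge Z i \<in> parallel_edges (turn (turn s)) \<and> cyc_edge Z (Suc i) \<in> parallel_edges (turn s)"
        using e_dir[of i] e_dir[of "Suc i"] unfolding cyc by (cases "even i") simp_all
    qed
  qed (simp_all add: edge_directions_eq)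
  ultimately have zigzag: "zigzag_cycle p q t Z" unfolding zigzag_cycle_def by blast
  have "e j \<in> M \<longleftrightarrow> e (Suc j) \<notin> M" for j
  proof (cases "even j")
    case True
    define w where "w = u + times_step (j div 2) s"
    have shift1: "w - lft (turn s) = w + \<delta> - rgt (turn s)" by (simp add: \<delta>_def)
    have shift2: "w + step s - lft (turn (turn s)) = w + \<delta> - rgt (turn (turn s))"
      using turn_shift[of s] by (simp add: \<delta>_def algebra_simps)
    have "Suc j div 2 = j div 2" using True by simp
    then have "e j = edge (w - lft (turn s)) (turn s)"
      "e (Suc j) = edge (w + step s - lft (turn (turn s))) (turn (turn s))"
      using True by (simp_all add: e_def Let_def w_def)
    then show ?thesis using matching_two_of_three_dn[OF M missing, of "w + \<delta>"]
      by (simp only: shift1 shift2)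
  next
    case False
    define w where "w = u + times_step (j div 2) s"
    have "Suc j div 2 = Suc (j div 2)" using False by presburger
    then have "u + times_step (Suc j div 2) s = w + step s" by (simp add: w_def add.assoc)
    then have "e j = edge (w + step s - lft (turn (turn s))) (turn (turn s))"
      "e (Suc j) = edge (w + step s - lft (turn s)) (turn s)"
      using False by (simp_all add: e_def Let_def w_def)
    then show ?thesis using matching_two_of_three_up[OF M missing, of "w + step s"]
      by (simp only: not_not)
  qed
  then have "alternating_cycle M Z" unfolding alternating_cycle_def cyc by blast
  with zigzag have "is_ladder p q t M Z" unfolding is_ladder_def by blast
  moreover have "e 0 = edge (u - lft (turn s)) (turn s)"
    "e 1 = edge (u + step s - lft (turn (turn s))) (turn (turn s))"
    by (simp_all add: e_def)
  ultimately show ?thesis using that cyc_edges by metis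
qed

text \<open>The ladders of \<open>M\<close> along the two remaining directions contain all edges of
  \<open>M\<close>, and \<open>N\<close> shares their matching edges.\<close>

lemma missing_direction_determined:
  assumes M: "polyhex_matching p q t M" and N: "polyhex_matching p q t N"
    and same: "same_ladders p q t M N" and missing: "\<And>x. edge x s \<notin> M"
  shows "M = N"
proof (rule matching_subset_imp_eq[OF M N], rule subsetI)
  fix e assume e: "e \<in> M"
  then obtain x r where x: "e = edge x r" using matching_subset[OF M] unfolding polyhex_edges_eq by blast
  with e missing have "r \<noteq> s" by blast
  then consider "r = turn s" | "r = turn (turn s)" using turn_exhaust by blast
  then obtain Z where "is_ladder p q t M Z" "e \<in> cyc_edges Z"
  proof cases
    case 1
    show thesis
    proof (rule missing_direction_ladder[OF M missing, where u = "x + lft r"])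
      fix Z assume "is_ladder p q t M Z" "edge (x + lft r - lft (turn s)) (turn s) \<in> cyc_edges Z"
      then show thesis using that[of Z] x 1 by simp
    qed
  next
    case 2
    show thesis
    proof (rule missing_direction_ladder[OF M missing, where u = "x + lft r - step s"])
      fix Z assume "is_ladder p q t M Z"
        "edge (x + lft r - step s + step s - lft (turn (turn s))) (turn (turn s)) \<in> cyc_edges Z"
      then show thesis using that[of Z] x 2 by simp
    qed
  qed
  then have "M \<inter> cyc_edges Z = N \<inter> cyc_edges Z"
    using same unfolding same_ladders_def is_ladder_def by blast
  with e \<open>e \<in> cyc_edges Z\<close> show "e \<in> N" by blast
qed

lemma walk_revisits:
  obtains i j :: nat where "i < j" "w i - w j \<in> G"
proof -
  obtain rep where rep: "\<And>x. rep x \<in> fundamental_domain" "\<And>x. x - rep x \<in> G" using fundamental_domain(2) by metis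
  have "finite (range (\<lambda>n. rep (w n)))" by (rule finite_subset[OF _ fundamental_domain(1)]) (use rep(1) in blast)
  then have "\<not> inj (\<lambda>n. rep (w n))" using finite_imageD infinite_UNIV_nat by blast
  then obtain i j where ij: "i < j" "rep (w i) = rep (w j)"
    unfolding inj_on_def by (metis linorder_neqE_nat)
  have "(w i - rep (w i)) - (w j - rep (w j)) \<in> G" using rep(2) by (rule diff_G[OF rep(2)])
  with ij that show ?thesis by simp
qed

text \<open>Let \<open>h\<close> be a potential of the normalized indicator of \<open>M\<close>.
  Along the walk and along its translate by \<open>z\<close>, the values of \<open>h\<close> differ
  by \<open>k\<close>, and the decrease of \<open>k\<close> is three times the number of edges of
  \<open>M\<close> crossed by the translate. When the walk returns to the same hexagon of the torus,
  \<open>k\<close> has its old value by quasi-periodicity, so the translate crosses no edge of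
  \<open>M\<close> in between. As \<open>z\<close> is arbitrary, all edges parallel to an edge
  crossed there are unmatched.\<close>

lemma unmatched_walk_imp_missing:
  assumes M: "polyhex_matching p q t M"
    and walk: "\<And>n. w n = w (Suc n) + step (d n)" "\<And>n :: nat. edge (w (Suc n)) (d n) \<notin> M"
  shows "\<exists>s. \<forall>y. edge y s \<notin> M"
proof -
  obtain h where h: "potential (\<lambda>x s. 3 * ind M x s - 1) h"
    using exists_potential[OF curl_free_density[OF M]] by blast
  obtain i j where ij: "i < j" "w i - w j \<in> G" using walk_revisits by blast
  have quasi: "h (x + (w i - w j)) - h x = h (w i - w j) - h 0" for x
  proof (rule potential_quasi_periodic[OF h])
    show "3 * ind M (x + (w i - w j)) s - 1 = 3 * ind M x s - 1" for x s
      using ind_periodic[of "x + (w i - w j)" x M s] ij(2) by simp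
  qed
  have "edge y (d i) \<notin> M" for y
  proof -
    define z where "z = y - w (Suc i)"
    define k where "k n = h (w n + z) - h (w n)" for n
    have k_Suc: "k n - k (Suc n) = 3 * ind M (w (Suc n) + z) (d n)" for n
    proof -
      have "h (w n + z) = h (w (Suc n) + z) + 3 * ind M (w (Suc n) + z) (d n) - 1"
        using h unfolding potential_def walk(1)[of n]
        by (metis (no_types, opaque_lifting) add.assoc add.commute diff_add_eq add_diff_eq)
      moreover have "h (w n) = h (w (Suc n)) + 3 * ind M (w (Suc n)) (d n) - 1"
        using h unfolding potential_def walk(1)[of n] by (metis add_diff_eq)
      moreover have "ind M (w (Suc n)) (d n) = 0" using walk(2)[of n] by simp
      ultimately show ?thesis by (simp add: k_def)
    qed
    have decreasing: "k (Suc n) \<le> k n" for n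
      using k_Suc[of n] ind_nonneg[of M "w (Suc n) + z" "d n"] by linarith
    have "k j \<le> k (Suc i)"
      by (rule lift_Suc_antimono_le[of k, OF decreasing]) (use ij(1) in simp)
    moreover have "k i = k j"
    proof -
      have "w j + z + (w i - w j) = w i + z" "w j + (w i - w j) = w i"
        by (simp_all add: algebra_simps)
      with quasi[of "w j + z"] quasi[of "w j"] show ?thesis by (simp add: k_def)
    qed
    ultimately have "ind M (w (Suc i) + z) (d i) \<le> 0" using k_Suc[of i] by linarith
    then have "ind M y (d i) = 0" using ind_nonneg[of M y "d i"] by (simp add: z_def)
    then show ?thesis by (simp only: ind_eq_0_iff not_False_eq_True)
  qed
  then show ?thesis by blast
qed

text \<open>To be used with the set \<open>S\<close> of hexagons at maximal height, none of which
  admits a lowering flip.\<close>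

lemma blocked_imp_missing:
  assumes M: "polyhex_matching p q t M" and "x \<in> S"
    and blocked: "\<And>x. x \<in> S \<Longrightarrow> \<exists>s. x - step s \<in> S \<and> edge (x - step s) s \<notin> M"
  shows "\<exists>s. \<forall>y. edge y s \<notin> M"
proof -
  obtain f where f: "\<And>x. x \<in> S \<Longrightarrow> x - step (f x) \<in> S \<and> edge (x - step (f x)) (f x) \<notin> M"
    using blocked by metis
  define w where "w n = ((\<lambda>x. x - step (f x)) ^^ n) x" for n
  have w_Suc: "w (Suc n) = w n - step (f (w n))" for n by (simp add: w_def)
  have S: "w n \<in> S" for n
    by (induction n) (use \<open>x \<in> S\<close> f in \<open>simp_all add: w_def\<close>)
  show ?thesis
  proof (rule unmatched_walk_imp_missing[OF M, of w "\<lambda>n. f (w n)"])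
    show "w n = w (Suc n) + step (f (w n))" for n by (simp add: w_Suc)
    show "edge (w (Suc n)) (f (w n)) \<notin> M" for n unfolding w_Suc using f[OF S] by blast
  qed
qed

section \<open>Connectedness\<close>

text \<open>Descent on the total height over a fundamental domain. At the maximum of
  \<open>h\<close>, an incoming arc whose edge is not in \<open>M\<close> starts at a point of
  height at least as large, hence maximal again; if this happened at every maximal point,
  \<open>M\<close> would miss a direction and coincide with \<open>N\<close>.\<close>

lemma connected_of_potential:
  assumes N: "polyhex_matching p q t N"
  shows "polyhex_matching p q t M \<Longrightarrow> same_ladders p q t M N \<Longrightarrow>
    potential (\<lambda>x s. ind M x s - ind N x s) h \<Longrightarrow> periodic h \<Longrightarrow> (\<And>x. h x \<ge> 0) \<Longrightarrow>
    (M, N) \<in> (resonance_adj p q t)\<^sup>*"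
proof (induction "nat (\<Sum>x\<in>fundamental_domain. h x)" arbitrary: M h rule: less_induct)
  case less
  note M = less.prems(1) and same = less.prems(2) and pot = less.prems(3)
    and per = less.prems(4) and nonneg = less.prems(5)
  have pot': "h (x + step s) = h x + (ind M x s - ind N x s)" for x s
    using pot unfolding potential_def by blast
  show ?case
  proof (cases "M = N")
    case True then show ?thesis by simp
  next
    case False
    have not_missing: "\<not> (\<exists>s. \<forall>y. edge y s \<notin> M)"
      using missing_direction_determined[OF M N same] False by blast
    define m where "m = Max (h ` fundamental_domain)"
    have h_rep: "\<exists>y\<in>fundamental_domain. h x = h y" for x using fundamental_domain(2)[of x] periodicD[OF per] by blast
    have le_m: "h x \<le> m" for x
      using h_rep[of x] fundamental_domain(1) unfolding m_def by auto
    have "fundamental_domain \<noteq> {}" using fundamental_domain(2) by blast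
    then have "m \<in> h ` fundamental_domain" unfolding m_def using fundamental_domain(1) by (intro Max_in) auto
    then obtain x0 where x0: "h x0 = m" by blast
    \<comment> \<open>Otherwise \<open>h\<close> vanishes and the matchings coincide. Positivity keeps \<open>h\<close> nonnegative under a
      flip at the maximum.\<close>
    have "m > 0"
    proof (rule ccontr)
      assume "\<not> m > 0"
      then have "h x = 0" for x using le_m[of x] nonneg[of x] by linarith
      then have "ind M x s = ind N x s" for x s using pot'[of x s] by simp
      then have "M = N" by (intro ind_eqI matching_subset M N)
      with False show False ..
    qed
    have "\<exists>x. h x = m \<and> (\<forall>s. edge (x - step s) s \<in> M)"
    proof (rule ccontr)
      assume none: "\<not> ?thesis"
      have "\<exists>s. \<forall>y. edge y s \<notin> M"
      proof (rule blocked_imp_missing[OF M, of x0 "{x. h x = m}"])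
        show "x0 \<in> {x. h x = m}" using x0 by simp
        fix x assume "x \<in> {x. h x = m}"
        then have x: "h x = m" by simp
        with none obtain s where s: "edge (x - step s) s \<notin> M" by blast
        then have "ind M (x - step s) s = 0" by (simp only: ind_eq_0_iff not_False_eq_True)
        then have "h x \<le> h (x - step s)"
          using pot'[of "x - step s" s] ind_nonneg[of N "x - step s" s]
          unfolding diff_add_cancel by linarith
        with x le_m[of "x - step s"] have "h (x - step s) = m" by simp
        with s show "\<exists>s. x - step s \<in> {x. h x = m} \<and> edge (x - step s) s \<notin> M" by blast
      qed
      with not_missing show False ..
    qed
    then obtain c where c: "h c = m" "\<And>s. edge (c - step s) s \<in> M" by blast
    obtain K where K: "(M, K) \<in> resonance_adj p q t"
      and ind_K: "\<And>x s. ind K x s = ind M x s + hex_ind c x - hex_ind c (x + step s)"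
      by (rule flip[OF M c(2)]) (rule that)
    define h' where "h' x = h x - hex_ind c x" for x
    have "(K, N) \<in> (resonance_adj p q t)\<^sup>*"
    proof (rule less.hyps)
      show "polyhex_matching p q t K" using K unfolding resonance_adj_def by blast
      show "same_ladders p q t K N"
        using same same_ladders_resonance_adj[OF resonance_adj_sym[OF K]] same_ladders_trans by blast
      show "potential (\<lambda>x s. ind K x s - ind N x s) h'"
        unfolding potential_def h'_def ind_K by (simp add: pot')
      show "periodic h'" using per periodic_hex_ind[of c] unfolding periodic_def h'_def by simp
      show h'_nonneg: "h' x \<ge> 0" for x
      proof (cases "x - c \<in> G")
        case True
        then have "h x = m" using periodicD[OF per] c(1) by metis
        with \<open>m > 0\<close> show ?thesis by (simp add: h'_def hex_ind_def)
      qed (simp add: h'_def hex_ind_def nonneg)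
      obtain y where "y \<in> fundamental_domain" "c - y \<in> G" using fundamental_domain(2) by blast
      then have y: "y \<in> fundamental_domain" "hex_ind c y = 1" using diff_G_commute by (auto simp: hex_ind_def)
      have "hex_ind c y \<le> (\<Sum>x\<in>fundamental_domain. hex_ind c x)"
        using y(1) fundamental_domain(1) by (intro member_le_sum) (auto simp: hex_ind_def)
      with y have "(\<Sum>x\<in>fundamental_domain. h' x) < (\<Sum>x\<in>fundamental_domain. h x)" by (simp add: h'_def sum_subtractf)
      moreover have "(\<Sum>x\<in>fundamental_domain. h' x) \<ge> 0" using h'_nonneg by (intro sum_nonneg)
      ultimately show "nat (\<Sum>x\<in>fundamental_domain. h' x) < nat (\<Sum>x\<in>fundamental_domain. h x)" by simp
    qed
    with K show ?thesis by (rule converse_rtrancl_into_rtrancl)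
  qed
qed

text \<open>By equality of the flows, the increment of the potential vanishes along both cut cycles,
  whose displacements are, up to sign, the two generators of the period lattice.\<close>

lemma connected_if_flow_ladders:
  assumes white: "proper_colouring (polyhex_edges p q t) white"
    and Lx: "cut_cycle_x p q t Lx" and Ly: "cut_cycle_y p q t Ly"
    and M: "polyhex_matching p q t M" and N: "polyhex_matching p q t N"
    and fx: "flow p q t white Lx M = flow p q t white Lx N"
    and fy: "flow p q t white Ly M = flow p q t white Ly N"
    and same: "same_ladders p q t M N"
  shows "(M, N) \<in> (resonance_adj p q t)\<^sup>*"
proof -
  obtain h where h: "potential (\<lambda>x s. ind M x s - ind N x s) h"
    using exists_potential[OF curl_free_diff[OF M N]] by blast
  have closed: "h (x + g) = h x"
    if L: "dual_cycle p q t L" "flow p q t white L M = flow p q t white L N"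
      and g: "last L - hd L = g \<or> last L - hd L = - g" and "g \<in> G" for L g x
  proof -
    have "ind K (x + g) s = ind K x s" for K x s
      using ind_periodic[of "x + g" x K s] \<open>g \<in> G\<close> by simp
    then have quasi: "h (x + g) - h x = h g - h 0" for x
      by (intro potential_quasi_periodic[OF h]) (simp only:)
    have "h (last L) = h (hd L)" using flow_diff[OF white L(1) h] L(2) by simp
    moreover from g have "last L = hd L + g \<or> hd L = last L + g" by (auto simp: algebra_simps)
    ultimately have "h g - h 0 = 0" using quasi[of "hd L"] quasi[of "last L"] by auto
    with quasi[of x] show ?thesis by simp
  qed
  have "(p, 0) = (1 * p + 0 * t, 0 * q)" "(t, q) = (0 * p + 1 * t, 1 * q)" by simp_all
  then have gens: "(p, 0) \<in> G" "(t, q) \<in> G"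
    unfolding translation_group_def by blast+
  have per: "periodic h"
  proof (rule periodic_if_generators)
    show "h (x + (p, 0)) = h x" for x
      using Lx fx gens(1) unfolding cut_cycle_x_def has_winding_vector_def
      by (intro closed[of Lx]) auto
    show "h (x + (t, q)) = h x" for x
      using Ly fy gens(2) unfolding cut_cycle_y_def has_winding_vector_def
      by (intro closed[of Ly]) auto
  qed
  \<comment> \<open>A potential is determined up to a constant; this choice makes it nonnegative.\<close>
  define h' where "h' x = h x - Min (h ` fundamental_domain)" for x
  have "h' x \<ge> 0" for x
  proof -
    obtain y where "y \<in> fundamental_domain" "h x = h y" using fundamental_domain(2)[of x] periodicD[OF per] by blast
    with fundamental_domain(1) show ?thesis by (simp add: h'_def)
  qed
  moreover have "potential (\<lambda>x s. ind M x s - ind N x s) h'"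
    using h unfolding potential_def h'_def by simp
  moreover have "periodic h'" using per unfolding periodic_def h'_def by simp
  ultimately show ?thesis using connected_of_potential[OF N M same] by blast
qed

lemma connected_imp_flow_ladders:
  assumes white: "proper_colouring (polyhex_edges p q t) white" and L: "dual_cycle p q t L"
    and "(M, N) \<in> (resonance_adj p q t)\<^sup>*"
  shows "flow p q t white L M = flow p q t white L N \<and> same_ladders p q t M N"
  using assms(3)
proof (induction rule: rtrancl_induct)
  case base then show ?case by (simp add: same_ladders_def)
next
  case (step K N)
  then show ?case
    using flow_resonance_adj[OF white L step.hyps(2)] same_ladders_resonance_adj[OF step.hyps(2)]
      same_ladders_trans by auto
qed

end


theorem theorem2p18:
  fixes p q t :: int
    and white :: "point set \<Rightarrow> bool"
    and Lx Ly :: "point list"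
    and M1 M2 :: "point set set set"
  assumes "p \<ge> 2" and "q \<ge> 2"
    and "proper_colouring (polyhex_edges p q t) white"
    and "cut_cycle_x p q t Lx" and "cut_cycle_y p q t Ly"
    and "polyhex_matching p q t M1" and "polyhex_matching p q t M2"
  shows "(M1, M2) \<in> (resonance_adj p q t)\<^sup>* \<longleftrightarrow>
           flow p q t white Lx M1 = flow p q t white Lx M2 \<and>
           flow p q t white Ly M1 = flow p q t white Ly M2 \<and>
           same_ladders p q t M1 M2"
proof -
  interpret polyhex p q t using assms(1,2) by unfold_locales
  have "dual_cycle p q t Lx" "dual_cycle p q t Ly"
    using assms(4,5) unfolding cut_cycle_x_def cut_cycle_y_def by blast+
  then show ?thesis
    using connected_imp_flow_ladders[OF assms(3)] connected_if_flow_ladders[OF assms(3-7)] by blast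
qed

end
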